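(* Let $(\Omega,d)$ be a metric space of finite diameter, let $\alpha\in(0,1]$, $\theta\in(0,1)$, and let $T:\Omega\to\Omega$ be a map of class $H(\alpha,\theta)$. For every $\alpha$-H\"older potential $\varphi:\Omega\to\mathbb{R}$ such that $$\operatorname{Hol}_\alpha(\varphi)\le\frac{2}{3(\operatorname{diam}\Omega)^\alpha}\log\Big(1+\frac{(1-\theta)^2}{16(1+\theta)}\Big),$$ the transfer operator $\mathrm{L}_\varphi$, acting on $\operatorname{Hol}_\alpha(\Omega)$, has a spectral gap with constant $1$.
   Context: A map $T:\Omega\to\Omega$ is of class $H(\alpha,\theta)$ if there exist an integer $k\ge2$ and "inverse branches" $b_1,\dots,b_k$ such that: (1) each $b_j$ is a Borel measurable map $\Omega\to\Omega$; (2) for all $x\in\Omega$ except possibly countably many, $T^{-1}(x)=\{b_1(x),\dots,b_k(x)\}$; (3) for all $y,z\in\Omega$ there is a permutation $\sigma$ of $\{1,\dots,k\}$ such that $\frac1k\sum_{j=1}^k d(b_j(y),b_{\sigma(j)}(z))^\alpha\le\theta\, d(y,z)^\alpha$. For such a map (with its inverse branches) and an $\alpha$-H\"older potential $\varphi$, the transfer operator is $$\mathrm{L}_\varphi f(x)=\frac1k\sum_{j=1}^k e^{\varphi(b_j(x))}f(b_j(x)).$$ $\operatorname{Hol}_\alpha(f)=\sup_{x\ne y}\frac{|f(x)-f(y)|}{d(x,y)^\alpha}$; $\operatorname{Hol}_\alpha(\Omega)$ is the Banach space of functions $f:\Omega\to\mathbb{R}$ with $\operatorname{Hol}_\alpha(f)<\infty$,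 endowed with the norm $\lVert f\rVert_{\operatorname{Hol}_\alpha}=\lVert f\rVert_\infty+(\operatorname{diam}\Omega)^\alpha\operatorname{Hol}_\alpha(f)$. A bounded linear operator $\mathrm{L}$ on a Banach space $\mathcal{X}$ has a spectral gap with constant $C>0$ if it has an eigenvalue $\lambda>0$ with an eigenvector $u_0$, and there are a closed subspace $G\subset\mathcal{X}$ with $\langle u_0\rangle\oplus G=\mathcal{X}$ and $\mathrm{L}(G)\subset G$, and a number $\delta\in(0,1)$, such that $\lVert (\mathrm{L}|_G)^n\rVert\le C\lambda^n(1-\delta)^n$ for all $n\in\mathbb{N}$. *)

theory Defs
  imports "HOL-Analysis.Analysis" "HOL-Library.Function_Algebras"
begin

instantiation "fun" :: (type, real_vector) real_vector
begin

definition scaleR_fun_def: "r *\<^sub>R f = (\<lambda>x. r *\<^sub>R f x)"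

instance
  by standard (simp_all add: scaleR_fun_def plus_fun_def scaleR_add_left scaleR_add_right)

end

lemma scaleR_fun_apply [simp]: "(r *\<^sub>R f) x = r *\<^sub>R f x"
  by (simp add: scaleR_fun_def)


section \<open>Spectral gap of an operator on a Banach space\<close>

text \<open>The Hoelder spaces depend on a real parameter, so they are not types. A normed space is
  therefore a carrier \<open>X\<close>, a linear subspace of a real vector space, together with a norm \<open>N\<close>
  that is only meaningful on \<open>X\<close>.\<close>

text \<open>The library locale \<^locale>\<open>Metric_space\<close> demands nonnegativity and symmetry also outside
  the carrier, hence the default value.\<close>

definition norm_dist :: "'v::real_vector set \<Rightarrow> ('v \<Rightarrow> real) \<Rightarrow> 'v \<Rightarrow> 'v \<Rightarrow> real" where
  "norm_dist X N x y = (if x \<in> X \<and> y \<in> X then N (x - y) else 0)"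

definition norm_on :: "'v::real_vector set \<Rightarrow> ('v \<Rightarrow> real) \<Rightarrow> bool" where
  "norm_on X N \<longleftrightarrow>
     (\<forall>x\<in>X. 0 \<le> N x) \<and>
     (\<forall>x\<in>X. N x = 0 \<longleftrightarrow> x = 0) \<and>
     (\<forall>x\<in>X. \<forall>y\<in>X. N (x + y) \<le> N x + N y) \<and>
     (\<forall>c. \<forall>x\<in>X. N (c *\<^sub>R x) = \<bar>c\<bar> * N x)"

definition banach_space_on :: "'v::real_vector set \<Rightarrow> ('v \<Rightarrow> real) \<Rightarrow> bool" where
  "banach_space_on X N \<longleftrightarrow>
     subspace X \<and> norm_on X N \<and> Metric_space.mcomplete X (norm_dist X N)"

definition bounded_operator_on ::
  "'v::real_vector set \<Rightarrow> ('v \<Rightarrow> real) \<Rightarrow> ('v \<Rightarrow> 'v) \<Rightarrow> bool" where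
  "bounded_operator_on X N L \<longleftrightarrow>
     L ` X \<subseteq> X \<and>
     (\<forall>x\<in>X. \<forall>y\<in>X. L (x + y) = L x + L y) \<and>
     (\<forall>c. \<forall>x\<in>X. L (c *\<^sub>R x) = c *\<^sub>R L x) \<and>
     (\<exists>K. \<forall>x\<in>X. N (L x) \<le> K * N x)"

text \<open>Operator norm of the restriction of \<open>A\<close> to \<open>G\<close>, in the same form as \<^const>\<open>onorm\<close>:
  the quotient at the zero vector is \<open>0\<close>.\<close>

definition onorm_on :: "'v::real_vector set \<Rightarrow> ('v \<Rightarrow> real) \<Rightarrow> ('v \<Rightarrow> 'v) \<Rightarrow> real" where
  "onorm_on G N A = (SUP x\<in>G. N (A x) / N x)"

definition has_spectral_gap ::
  "'v::real_vector set \<Rightarrow> ('v \<Rightarrow> real) \<Rightarrow> ('v \<Rightarrow> 'v) \<Rightarrow> real \<Rightarrow> bool" where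
  "has_spectral_gap X N L C \<longleftrightarrow>
     banach_space_on X N \<and> bounded_operator_on X N L \<and> 0 < C \<and>
     (\<exists>lam u\<^sub>0 G \<delta>.
        0 < lam \<and> u\<^sub>0 \<in> X \<and> u\<^sub>0 \<noteq> 0 \<and> L u\<^sub>0 = lam *\<^sub>R u\<^sub>0 \<and>
        subspace G \<and> G \<subseteq> X \<and>
        closedin (Metric_space.mtopology X (norm_dist X N)) G \<and>
        span {u\<^sub>0} \<inter> G = {0} \<and> {v + g | v g. v \<in> span {u\<^sub>0} \<and> g \<in> G} = X \<and>
        L ` G \<subseteq> G \<and>
        0 < \<delta> \<and> \<delta> < 1 \<and>
        (\<forall>n::nat. onorm_on G N (L ^^ n) \<le> C * lam ^ n * (1 - \<delta>) ^ n))"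


section \<open>Hoelder functions\<close>

text \<open>The supremum is taken in the extended nonnegative reals, so that it is \<open>\<infinity>\<close> for functions
  that are not Hoelder and \<open>0\<close> on a one-point space.\<close>

definition holder_const :: "real \<Rightarrow> ('a::metric_space \<Rightarrow> real) \<Rightarrow> ennreal" where
  "holder_const \<alpha> f =
     (SUP (x, y) \<in> {(x, y). x \<noteq> y}. ennreal (\<bar>f x - f y\<bar> / dist x y powr \<alpha>))"

definition holder_space :: "real \<Rightarrow> ('a::metric_space \<Rightarrow> real) set" where
  "holder_space \<alpha> = {f. holder_const \<alpha> f < \<infinity>}"

definition holder_norm :: "real \<Rightarrow> ('a::metric_space \<Rightarrow> real) \<Rightarrow> real" where
  "holder_norm \<alpha> f =
     (SUP x. \<bar>f x\<bar>) + diameter (UNIV :: 'a set) powr \<alpha> * enn2real (holder_const \<alpha> f)"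


section \<open>Maps with inverse branches and their transfer operators\<close>

text \<open>\<open>T\<close> is of class \<open>H(\<alpha>, \<theta>)\<close> iff \<open>inverse_branches \<alpha> \<theta> T k b\<close> for some \<open>k\<close> and \<open>b\<close>. The
  branches are kept explicit because the transfer operator depends on them.\<close>

definition inverse_branches ::
  "real \<Rightarrow> real \<Rightarrow> ('a::metric_space \<Rightarrow> 'a) \<Rightarrow> nat \<Rightarrow> (nat \<Rightarrow> 'a \<Rightarrow> 'a) \<Rightarrow> bool" where
  "inverse_branches \<alpha> \<theta> T k b \<longleftrightarrow>
     2 \<le> k \<and>
     (\<forall>j\<in>{1..k}. b j \<in> borel_measurable borel) \<and>
     countable {x. T -` {x} \<noteq> (\<lambda>j. b j x) ` {1..k}} \<and>
     (\<forall>y z. \<exists>\<sigma>. \<sigma> permutes {1..k} \<and>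
        1 / real k * (\<Sum>j=1..k. dist (b j y) (b (\<sigma> j) z) powr \<alpha>) \<le> \<theta> * dist y z powr \<alpha>)"

definition transfer_operator ::
  "nat \<Rightarrow> (nat \<Rightarrow> 'a \<Rightarrow> 'a) \<Rightarrow> ('a \<Rightarrow> real) \<Rightarrow> ('a \<Rightarrow> real) \<Rightarrow> 'a \<Rightarrow> real" where
  "transfer_operator k b \<phi> f x = 1 / real k * (\<Sum>j=1..k. exp (\<phi> (b j x)) * f (b j x))"

end

theory Submission
  imports Defs
begin

text \<open>The argument is a Ruelle--Perron--Frobenius argument by contraction, which needs no compactness.
  After subtracting a constant from the potential, the weights lie in \<open>[1, E]\<close> with \<open>E\<close> close to \<open>1\<close>.
  As the branches contract by \<open>\<theta>\<close> on average, the operator \<open>A\<close> contracts the Hoelder seminorm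
  up to small errors, and the normalised map \<open>f \<mapsto> A f / A f x\<^sub>0\<close> is a contraction of a set of functions
  close to \<open>1\<close>; its fixed point is a positive eigenfunction \<open>u\<close> with eigenvalue \<open>lam\<close>. The same estimate
  on the quotient by \<open>u\<close> gives the convergence of \<open>(A ^^ n) f x\<^sub>0 / lam ^ n\<close> to a positive functional
  \<open>\<nu>\<close> with \<open>\<nu> (A f) = lam * \<nu> f\<close>, and \<open>G\<close> is the kernel of \<open>\<nu>\<close>. By positivity, a function in \<open>G\<close> is
  not bounded away from \<open>0\<close>, so its sup norm is at most its scaled Hoelder seminorm; this is what makes
  \<open>A\<close> contract the full norm on \<open>G\<close> in a single step, hence the constant \<open>1\<close>.\<close>

section \<open>Hoelder spaces\<close>

text \<open>A real-valued counterpart of \<open>holder_const\<close>, so that estimates become plain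
  real arithmetic. The inequality does not imply \<open>0 \<le> C\<close>: on a one-point space it
  holds for every \<open>C\<close>.\<close>

definition holder_bound :: "real \<Rightarrow> real \<Rightarrow> ('a::metric_space \<Rightarrow> real) \<Rightarrow> bool" where
  "holder_bound \<alpha> C f \<longleftrightarrow> 0 \<le> C \<and> (\<forall>x y. \<bar>f x - f y\<bar> \<le> C * dist x y powr \<alpha>)"

lemma holder_boundD: "holder_bound \<alpha> C f \<Longrightarrow> \<bar>f x - f y\<bar> \<le> C * dist x y powr \<alpha>"
  and holder_bound_nonneg: "holder_bound \<alpha> C f \<Longrightarrow> 0 \<le> C"
  by (auto simp: holder_bound_def)

lemma holder_bound_mono: "holder_bound \<alpha> C f \<Longrightarrow> C \<le> C' \<Longrightarrow> holder_bound \<alpha> C' f"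
  unfolding holder_bound_def by (meson mult_right_mono order_trans powr_ge_zero)

lemma holder_bound_const [simp]: "0 \<le> C \<Longrightarrow> holder_bound \<alpha> C (\<lambda>_. c)"
  by (simp add: holder_bound_def)

lemma holder_bound_add:
  assumes "holder_bound \<alpha> C f" "holder_bound \<alpha> C' f'"
  shows "holder_bound \<alpha> (C + C') (\<lambda>x. f x + f' x)"
  unfolding holder_bound_def
proof (intro conjI allI)
  show "0 \<le> C + C'" using assms by (simp add: holder_bound_def)
  fix x y
  show "\<bar>f x + f' x - (f y + f' y)\<bar> \<le> (C + C') * dist x y powr \<alpha>"
    using holder_boundD[OF assms(1), of x y] holder_boundD[OF assms(2), of x y]
    by (simp add: algebra_simps)
qed

lemma holder_bound_cmult:
  assumes "holder_bound \<alpha> C f"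
  shows "holder_bound \<alpha> (\<bar>c\<bar> * C) (\<lambda>x. c * f x)"
  unfolding holder_bound_def
proof (intro conjI allI)
  show "0 \<le> \<bar>c\<bar> * C" using assms by (simp add: holder_bound_def)
  fix x y
  have "\<bar>c * f x - c * f y\<bar> = \<bar>c\<bar> * \<bar>f x - f y\<bar>"
    by (metis abs_mult right_diff_distrib)
  then show "\<bar>c * f x - c * f y\<bar> \<le> \<bar>c\<bar> * C * dist x y powr \<alpha>"
    using mult_left_mono[OF holder_boundD[OF assms, of x y], of "\<bar>c\<bar>"] by (simp add: mult.assoc)
qed

lemma holder_bound_diff:
  assumes "holder_bound \<alpha> C f" "holder_bound \<alpha> C' f'"
  shows "holder_bound \<alpha> (C + C') (\<lambda>x. f x - f' x)"
  using holder_bound_add[OF assms(1) holder_bound_cmult[OF assms(2), of "-1"]] by simp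

lemma holder_bound_lim:
  assumes "\<And>n. holder_bound \<alpha> C (f n)" "\<And>x. (\<lambda>n. f n x) \<longlonglongrightarrow> g x"
  shows "holder_bound \<alpha> C g"
  unfolding holder_bound_def
proof (intro conjI allI)
  show "0 \<le> C" using assms(1) by (simp add: holder_bound_def)
  fix x y
  have "(\<lambda>n. \<bar>f n x - f n y\<bar>) \<longlonglongrightarrow> \<bar>g x - g y\<bar>"
    by (intro tendsto_intros assms)
  then show "\<bar>g x - g y\<bar> \<le> C * dist x y powr \<alpha>"
    by (rule LIMSEQ_le_const2) (use holder_boundD[OF assms(1)] in blast)
qed

lemma holder_const_le_iff:
  assumes "0 \<le> C"
  shows "holder_const \<alpha> f \<le> ennreal C \<longleftrightarrow> holder_bound \<alpha> C f"
proof -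
  have "\<bar>f x - f y\<bar> / dist x y powr \<alpha> \<le> C \<longleftrightarrow> \<bar>f x - f y\<bar> \<le> C * dist x y powr \<alpha>"
    if "x \<noteq> y" for x y
    using that by (simp add: divide_le_eq)
  then have "(\<forall>x y. x \<noteq> y \<longrightarrow> \<bar>f x - f y\<bar> / dist x y powr \<alpha> \<le> C) \<longleftrightarrow>
      (\<forall>x y. \<bar>f x - f y\<bar> \<le> C * dist x y powr \<alpha>)"
    by (metis assms abs_0 diff_self mult_nonneg_nonneg powr_ge_zero)
  then show ?thesis
    using assms by (auto simp: holder_const_def holder_bound_def SUP_le_iff)
qed

abbreviation Hol :: "real \<Rightarrow> ('a::metric_space \<Rightarrow> real) \<Rightarrow> real" where
  "Hol \<alpha> f \<equiv> enn2real (holder_const \<alpha> f)"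

lemma holder_bound_Hol:
  assumes "f \<in> holder_space \<alpha>"
  shows "holder_bound \<alpha> (Hol \<alpha> f) f"
proof -
  have "holder_const \<alpha> f \<le> ennreal (Hol \<alpha> f)"
    using assms by (simp add: holder_space_def)
  then show ?thesis by (simp add: holder_const_le_iff)
qed

lemma holder_bound_imp:
  assumes "holder_bound \<alpha> C f"
  shows "f \<in> holder_space \<alpha>" and "Hol \<alpha> f \<le> C"
proof -
  have C: "0 \<le> C" and le: "holder_const \<alpha> f \<le> ennreal C"
    using assms holder_bound_nonneg holder_const_le_iff by blast+
  show "f \<in> holder_space \<alpha>"
    using le by (simp add: holder_space_def le_less_trans[OF le])
  show "Hol \<alpha> f \<le> C"
    using enn2real_mono[OF le] C by simp
qed

lemma subspace_holder_space: "subspace (holder_space \<alpha>)"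
proof (rule subspaceI)
  show "(0 :: 'a \<Rightarrow> real) \<in> holder_space \<alpha>"
    using holder_bound_imp(1)[OF holder_bound_const[of 0 \<alpha> 0]] by (simp add: zero_fun_def)
next
  fix f f' :: "'a \<Rightarrow> real"
  assume "f \<in> holder_space \<alpha>" "f' \<in> holder_space \<alpha>"
  then show "f + f' \<in> holder_space \<alpha>"
    using holder_bound_imp(1)[OF holder_bound_add[OF holder_bound_Hol holder_bound_Hol]]
    by (simp add: plus_fun_def)
next
  fix c :: real and f :: "'a \<Rightarrow> real"
  assume "f \<in> holder_space \<alpha>"
  then show "c *\<^sub>R f \<in> holder_space \<alpha>"
    using holder_bound_imp(1)[OF holder_bound_cmult[OF holder_bound_Hol, of f \<alpha> c]]
    by (simp add: scaleR_fun_def)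
qed

lemma dist_powr_le_diam:
  fixes x y :: "'a::metric_space"
  assumes "bounded (UNIV :: 'a set)" "0 < \<alpha>"
  shows "dist x y powr \<alpha> \<le> diameter (UNIV :: 'a set) powr \<alpha>"
  using assms by (intro powr_mono2) (auto intro: diameter_bounded_bound)

lemma holder_bound_osc:
  fixes f :: "'a::metric_space \<Rightarrow> real"
  assumes "bounded (UNIV :: 'a set)" "0 < \<alpha>" "holder_bound \<alpha> C f"
  shows "\<bar>f x - f y\<bar> \<le> diameter (UNIV :: 'a set) powr \<alpha> * C"
  using holder_boundD[OF assms(3), of x y]
    mult_left_mono[OF dist_powr_le_diam[OF assms(1,2), of x y] holder_bound_nonneg[OF assms(3)]]
  by (simp add: mult.commute)

text \<open>On a bounded space Hoelder functions are bounded, so the real supremum in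
  \<open>holder_norm\<close> is a genuine one.\<close>

lemma abs_le_Sup_abs:
  fixes f :: "'a::metric_space \<Rightarrow> real"
  assumes "bounded (UNIV :: 'a set)" "0 < \<alpha>" "f \<in> holder_space \<alpha>"
  shows "\<bar>f x\<bar> \<le> (SUP x. \<bar>f x\<bar>)"
proof (rule cSUP_upper)
  show "bdd_above (range (\<lambda>x. \<bar>f x\<bar>))"
  proof (rule bdd_aboveI2)
    fix y
    show "\<bar>f y\<bar> \<le> \<bar>f x\<bar> + diameter (UNIV :: 'a set) powr \<alpha> * Hol \<alpha> f"
      using holder_bound_osc[OF assms(1,2) holder_bound_Hol[OF assms(3)], of y x] by linarith
  qed
qed simp

lemma Sup_abs_nonneg:
  fixes f :: "'a::metric_space \<Rightarrow> real"
  assumes "bounded (UNIV :: 'a set)" "0 < \<alpha>" "f \<in> holder_space \<alpha>"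
  shows "0 \<le> (SUP x. \<bar>f x\<bar>)"
  using abs_le_Sup_abs[OF assms] abs_ge_zero order_trans by blast

lemma holder_norm_le:
  fixes f :: "'a::metric_space \<Rightarrow> real"
  assumes "\<And>x. \<bar>f x\<bar> \<le> S" "holder_bound \<alpha> C f"
  shows "holder_norm \<alpha> f \<le> S + diameter (UNIV :: 'a set) powr \<alpha> * C"
  unfolding holder_norm_def
  by (intro add_mono cSUP_least mult_left_mono holder_bound_imp) (use assms in auto)

lemma abs_le_holder_norm:
  fixes f :: "'a::metric_space \<Rightarrow> real"
  assumes "bounded (UNIV :: 'a set)" "0 < \<alpha>" "f \<in> holder_space \<alpha>"
  shows "\<bar>f x\<bar> \<le> holder_norm \<alpha> f"
  unfolding holder_norm_def
  by (intro order_trans[OF abs_le_Sup_abs[OF assms]]) simp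

section \<open>The Hoelder norm and its completeness\<close>

lemma norm_on_holder:
  assumes "bounded (UNIV :: 'a::metric_space set)" "0 < \<alpha>"
  shows "norm_on (holder_space \<alpha> :: ('a \<Rightarrow> real) set) (holder_norm \<alpha>)"
  unfolding norm_on_def
proof (intro conjI ballI allI)
  note b = abs_le_Sup_abs[OF assms] and h = holder_bound_Hol
  show nn: "0 \<le> holder_norm \<alpha> f" if "f \<in> holder_space \<alpha>" for f :: "'a \<Rightarrow> real"
    unfolding holder_norm_def using Sup_abs_nonneg[OF assms that] by simp
  show "holder_norm \<alpha> (f + f') \<le> holder_norm \<alpha> f + holder_norm \<alpha> f'"
    if "f \<in> holder_space \<alpha>" "f' \<in> holder_space \<alpha>" for f f' :: "'a \<Rightarrow> real"
  proof -
    have "\<bar>(f + f') x\<bar> \<le> (SUP x. \<bar>f x\<bar>) + (SUP x. \<bar>f' x\<bar>)" for x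
      using b[OF that(1), of x] b[OF that(2), of x] by simp
    then have "holder_norm \<alpha> (f + f') \<le> (SUP x. \<bar>f x\<bar>) + (SUP x. \<bar>f' x\<bar>)
        + diameter (UNIV :: 'a set) powr \<alpha> * (Hol \<alpha> f + Hol \<alpha> f')"
      by (rule holder_norm_le)
        (use holder_bound_add[OF h[OF that(1)] h[OF that(2)]] in \<open>simp add: plus_fun_def\<close>)
    then show ?thesis by (simp add: holder_norm_def algebra_simps)
  qed
  \<comment> \<open>Only an inequality; used with the scalar \<open>1 / c\<close> it also yields the
    reverse one.\<close>
  have scale_le: "holder_norm \<alpha> (c *\<^sub>R f) \<le> \<bar>c\<bar> * holder_norm \<alpha> f"
    if "f \<in> holder_space \<alpha>" for c and f :: "'a \<Rightarrow> real"
  proof -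
    have "\<bar>(c *\<^sub>R f) x\<bar> \<le> \<bar>c\<bar> * (SUP x. \<bar>f x\<bar>)" for x
      using b[OF that, of x] by (simp add: abs_mult mult_left_mono)
    moreover have "holder_bound \<alpha> (\<bar>c\<bar> * Hol \<alpha> f) (c *\<^sub>R f)"
      using holder_bound_cmult[OF h[OF that], of c] by (simp add: scaleR_fun_def)
    ultimately have "holder_norm \<alpha> (c *\<^sub>R f)
        \<le> \<bar>c\<bar> * (SUP x. \<bar>f x\<bar>) + diameter (UNIV :: 'a set) powr \<alpha> * (\<bar>c\<bar> * Hol \<alpha> f)"
      by (rule holder_norm_le)
    then show ?thesis by (simp add: holder_norm_def algebra_simps)
  qed
  have zero: "holder_norm \<alpha> (0 :: 'a \<Rightarrow> real) = 0"
    using scale_le[of 0 0] nn[of 0] subspace_0[OF subspace_holder_space] by fastforce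
  show "holder_norm \<alpha> f = 0 \<longleftrightarrow> f = 0" if "f \<in> holder_space \<alpha>" for f :: "'a \<Rightarrow> real"
    using abs_le_holder_norm[OF assms that] zero by (fastforce simp: fun_eq_iff)
  show "holder_norm \<alpha> (c *\<^sub>R f) = \<bar>c\<bar> * holder_norm \<alpha> f"
    if "f \<in> holder_space \<alpha>" for c and f :: "'a \<Rightarrow> real"
  proof (cases "c = 0")
    case True
    then show ?thesis by (simp add: zero)
  next
    case False
    have "holder_norm \<alpha> ((1 / c) *\<^sub>R (c *\<^sub>R f)) \<le> \<bar>1 / c\<bar> * holder_norm \<alpha> (c *\<^sub>R f)"
      using that by (intro scale_le subspace_scale[OF subspace_holder_space])
    with False have "\<bar>c\<bar> * holder_norm \<alpha> f \<le> holder_norm \<alpha> (c *\<^sub>R f)"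
      by (simp add: field_simps)
    with scale_le[OF that] show ?thesis by (simp add: antisym)
  qed
qed

lemma Metric_space_norm_dist:
  assumes "subspace X" "norm_on X N"
  shows "Metric_space X (norm_dist X N)"
proof
  have neg: "N (x - y) = N (y - x)" if "x \<in> X" "y \<in> X" for x y
  proof -
    have "y - x \<in> X" using assms(1) that by (simp add: subspace_diff)
    then have "N ((-1) *\<^sub>R (y - x)) = \<bar>-1\<bar> * N (y - x)"
      using assms(2) unfolding norm_on_def by blast
    then show ?thesis by simp
  qed
  show "0 \<le> norm_dist X N x y" for x y
    using assms subspace_diff by (auto simp: norm_dist_def norm_on_def)
  show "norm_dist X N x y = norm_dist X N y x" for x y
    using neg by (simp add: norm_dist_def)
  show "norm_dist X N x y = 0 \<longleftrightarrow> x = y" if "x \<in> X" "y \<in> X" for x y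
    using assms that subspace_diff[of X x y] by (simp add: norm_dist_def norm_on_def)
  show "norm_dist X N x z \<le> norm_dist X N x y + norm_dist X N y z"
    if "x \<in> X" "y \<in> X" "z \<in> X" for x y z
  proof -
    have "x - y \<in> X" "y - z \<in> X" using assms(1) that by (simp_all add: subspace_diff)
    then have "N ((x - y) + (y - z)) \<le> N (x - y) + N (y - z)"
      using assms(2) unfolding norm_on_def by blast
    then show ?thesis using that by (simp add: norm_dist_def)
  qed
qed

text \<open>A norm-Cauchy sequence converges pointwise, and bounds on the sup norm and the seminorm
  of \<open>F n - F m\<close> survive the pointwise limit in \<open>m\<close>.\<close>

lemma banach_space_on_holder:
  assumes "bounded (UNIV :: 'a::metric_space set)" "0 < \<alpha>"
  shows "banach_space_on (holder_space \<alpha> :: ('a \<Rightarrow> real) set) (holder_norm \<alpha>)"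
proof -
  let ?X = "holder_space \<alpha> :: ('a \<Rightarrow> real) set" and ?N = "holder_norm \<alpha> :: ('a \<Rightarrow> real) \<Rightarrow> real"
  let ?D = "diameter (UNIV :: 'a set) powr \<alpha>"
  note sub = subspace_holder_space and no = norm_on_holder[OF assms]
  interpret M: Metric_space ?X "norm_dist ?X ?N"
    by (rule Metric_space_norm_dist[OF sub no])
  have "\<exists>f. limitin M.mtopology F f sequentially" if F: "M.MCauchy F" for F
  proof -
    have FX: "F n \<in> ?X" for n using F by (auto simp: M.MCauchy_def)
    have dX: "F n - F m \<in> ?X" for n m by (intro subspace_diff[OF sub] FX)
    have cau: "\<exists>n0. \<forall>n\<ge>n0. \<forall>m\<ge>n0. ?N (F n - F m) < e" if "0 < e" for e
      using F that FX unfolding M.MCauchy_def norm_dist_def by fastforce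
    have "Cauchy (\<lambda>n. F n x)" for x
    proof (rule metric_CauchyI)
      fix e :: real assume "0 < e"
      then obtain n0 where n0: "\<forall>n\<ge>n0. \<forall>m\<ge>n0. ?N (F n - F m) < e"
        using cau[OF \<open>0 < e\<close>] by blast
      show "\<exists>M. \<forall>m\<ge>M. \<forall>n\<ge>M. dist (F m x) (F n x) < e"
      proof (intro exI allI impI)
        fix m n assume "m \<ge> n0" "n \<ge> n0"
        then show "dist (F m x) (F n x) < e"
          using abs_le_holder_norm[OF assms dX, of m n x] n0
          by (fastforce simp: dist_real_def)
      qed
    qed
    then have "\<exists>l. (\<lambda>n. F n x) \<longlonglongrightarrow> l" for x
      by (simp add: Cauchy_convergent_iff convergent_def)
    then obtain f where f: "\<And>x. (\<lambda>n. F n x) \<longlonglongrightarrow> f x" by metis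
    \<comment> \<open>The factor 2 arises because the sup part and the seminorm part are bounded by
      \<open>e\<close> separately.\<close>
    have close: "\<exists>n0. \<forall>n\<ge>n0. f \<in> ?X \<and> ?N (F n - f) \<le> 2 * e" if "0 < e" for e
    proof -
      obtain n0 where n0: "\<forall>n\<ge>n0. \<forall>m\<ge>n0. ?N (F n - F m) < e"
        using cau[OF \<open>0 < e\<close>] by blast
      have "f \<in> ?X \<and> ?N (F n - f) \<le> 2 * e" if n: "n \<ge> n0" for n
      proof -
        have lim: "(\<lambda>m. F n x - F (m + n0) x) \<longlonglongrightarrow> F n x - f x" for x
          by (intro tendsto_intros LIMSEQ_ignore_initial_segment f)
        have le: "?N (F n - F (m + n0)) \<le> e" for m
          using n0 n by (simp add: less_imp_le)
        have "\<bar>F n x - F (m + n0) x\<bar> \<le> e" for m x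
          using abs_le_holder_norm[OF assms dX, of n "m + n0" x] le[of m] by simp
        then have sup: "\<bar>(F n - f) x\<bar> \<le> e" for x
          using LIMSEQ_le_const2[OF tendsto_rabs[OF lim[of x]], of e] by auto
        \<comment> \<open>If \<open>?D = 0\<close>, the space has one point, and the bound \<open>e / ?D = 0\<close> is still correct.\<close>
        have "holder_bound \<alpha> (e / ?D) (\<lambda>x. F n x - F (m + n0) x)" for m
        proof (cases "?D = 0")
          case True
          have "dist x y \<le> 0" for x y :: 'a
            using diameter_bounded_bound[OF assms(1), of x y] True by simp
          then have eq: "x = y" for x y :: 'a by simp
          show ?thesis
            unfolding holder_bound_def
          proof (intro conjI allI)
            fix x y
            show "\<bar>F n x - F (m + n0) x - (F n y - F (m + n0) y)\<bar> \<le> e / ?D * dist x y powr \<alpha>"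
              by (simp add: True eq[of x y])
          qed (simp add: True)
        next
          case False
          then have D: "?D > 0" by (simp add: less_le)
          have "0 \<le> (SUP x. \<bar>(F n - F (m + n0)) x\<bar>)" by (rule Sup_abs_nonneg[OF assms dX])
          then have "?D * Hol \<alpha> (F n - F (m + n0)) \<le> e"
            using le[of m] unfolding holder_norm_def by linarith
          then have "Hol \<alpha> (F n - F (m + n0)) \<le> e / ?D"
            using D by (simp add: field_simps)
          then show ?thesis
            using holder_bound_mono[OF holder_bound_Hol[OF dX]] by (simp add: fun_diff_def)
        qed
        then have hb: "holder_bound \<alpha> (e / ?D) (F n - f)"
          unfolding fun_diff_def by (rule holder_bound_lim) (rule lim)
        have "?N (F n - f) \<le> e + ?D * (e / ?D)"
          by (rule holder_norm_le[OF sup hb])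
        also have "\<dots> \<le> 2 * e" using \<open>0 < e\<close> by simp
        finally have "?N (F n - f) \<le> 2 * e" .
        moreover have "F n - (F n - f) \<in> ?X"
          by (intro subspace_diff[OF sub] FX holder_bound_imp(1)[OF hb])
        ultimately show ?thesis by simp
      qed
      then show ?thesis by blast
    qed
    have fX: "f \<in> ?X" using close[of 1] by auto
    have "\<exists>n0. \<forall>n\<ge>n0. norm_dist ?X ?N (F n) f < e" if "0 < e" for e
    proof -
      obtain n0 where "\<forall>n\<ge>n0. ?N (F n - f) \<le> 2 * (e / 3)" using close[of "e / 3"] \<open>0 < e\<close> by auto
      then show ?thesis using \<open>0 < e\<close> FX fX by (force simp: norm_dist_def intro!: exI[of _ n0])
    qed
    then have "limitin M.mtopology F f sequentially"
      using FX fX by (auto simp: M.limit_metric_sequentially)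
    then show ?thesis by blast
  qed
  then show ?thesis
    using sub no by (simp add: banach_space_on_def M.mcomplete_def)
qed

section \<open>Weighted averages over inverse branches\<close>

text \<open>Expresses that normalising \<open>A f\<close> does not increase the Hoelder constant
  \<open>C\<close>, after cancelling \<open>\<eta> / (1 - \<theta>)\<close> and bounding the
  denominator below by \<open>1 - a\<close>, where \<open>a = (1 - \<theta>) / 8\<close>.\<close>

lemma invariance_estimate:
  fixes \<theta> E :: real
  assumes "0 < \<theta>" "\<theta> < 1" "1 \<le> E" "E \<le> 1 + (1 - \<theta>)\<^sup>2 / 6"
  shows "\<theta> * E * (3 + (1 - \<theta>) * (1 + (1 - \<theta>) / 8)) \<le> 3 * (1 - (1 - \<theta>) / 8)"
proof -
  define \<delta> where "\<delta> = 1 - \<theta>"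
  have \<delta>: "0 < \<delta>" "\<delta> < 1" "\<theta> = 1 - \<delta>" using assms by (auto simp: \<delta>_def)
  have sq: "0 \<le> \<delta>\<^sup>2" "\<delta>\<^sup>2 \<le> \<delta>" "0 \<le> \<delta>^3" using \<delta> by (auto simp: power2_eq_square mult_le_one)
  have "\<theta> * (3 + \<delta> * (1 + \<delta> / 8)) \<le> 3 - 2 * \<delta>"
    unfolding \<delta>(3) using sq by (simp add: algebra_simps power2_eq_square power3_eq_cube)
  then have "\<theta> * (3 + \<delta> * (1 + \<delta> / 8)) * E \<le> (3 - 2 * \<delta>) * (1 + \<delta>\<^sup>2 / 6)"
    using assms \<delta> by (intro mult_mono) auto
  also have "\<dots> = 3 - 2 * \<delta> + \<delta>\<^sup>2 / 2 - \<delta>^3 / 3"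
    by (simp add: algebra_simps power2_eq_square power3_eq_cube)
  also have "\<dots> \<le> 3 - 3 * \<delta> / 8"
    using sq \<delta> by linarith
  also have "\<dots> = 3 * (1 - \<delta> / 8)" by simp
  finally show ?thesis by (simp add: \<delta>_def mult_ac)
qed

text \<open>Gives \<open>\<kappa> < 1\<close>. The eighth on the left is the cost of renormalising
  at the base point, the one on the right comes from the lower bound for the normalising
  factor.\<close>

lemma contraction_estimate:
  fixes \<theta> E \<epsilon> :: real
  assumes "0 < \<theta>" "\<theta> < 1" "1 \<le> E" "E \<le> 1 + (1 - \<theta>)\<^sup>2 / 6" "0 \<le> \<epsilon>" "\<epsilon> \<le> (1 - \<theta>)\<^sup>2 / 24"
  shows "E * (\<theta> * (1 + \<epsilon>) + (1 - \<theta>) / 8) < 1 - (1 - \<theta>) / 8"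
proof -
  define \<delta> where "\<delta> = 1 - \<theta>"
  have \<delta>: "0 < \<delta>" "\<delta> < 1" "\<theta> = 1 - \<delta>" using assms by (auto simp: \<delta>_def)
  have sq: "0 \<le> \<delta>\<^sup>2" "\<delta>\<^sup>2 \<le> \<delta>" "0 \<le> \<delta>^3" using \<delta> by (auto simp: power2_eq_square mult_le_one)
  have "\<theta> * \<epsilon> \<le> \<epsilon>" using assms by (simp add: mult_left_le_one_le)
  then have "\<theta> * (1 + \<epsilon>) + \<delta> / 8 \<le> 1 - 5 * \<delta> / 6"
    using sq assms(6) \<delta>(3) unfolding \<delta>_def[symmetric] distrib_left by linarith
  then have "E * (\<theta> * (1 + \<epsilon>) + \<delta> / 8) \<le> (1 + \<delta>\<^sup>2 / 6) * (1 - 5 * \<delta> / 6)"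
    using assms \<delta> by (intro mult_mono) auto
  also have "\<dots> = 1 - 5 * \<delta> / 6 + \<delta>\<^sup>2 / 6 - 5 * \<delta>^3 / 36"
    by (simp add: algebra_simps power2_eq_square power3_eq_cube)
  also have "\<dots> < 1 - \<delta> / 8"
    using sq \<delta> by linarith
  finally show ?thesis by (simp add: \<delta>_def)
qed

text \<open>Divided by \<open>1 + \<theta>\<close>, this puts the norm bound \<open>\<rho>\<close>
  on \<open>G\<close> strictly below \<open>1 - a\<close>, a lower bound for the eigenvalue.\<close>

lemma gap_estimate:
  fixes \<theta> E \<epsilon> :: real
  assumes "0 < \<theta>" "\<theta> < 1" "1 \<le> E" "E \<le> 1 + (1 - \<theta>)\<^sup>2 / 6" "0 \<le> \<epsilon>" "\<epsilon> \<le> (1 - \<theta>)\<^sup>2 / 24"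
  shows "E * (2 * \<theta> * (1 + \<epsilon>)) < (1 + \<theta>) * (1 - (1 - \<theta>) / 8)"
proof -
  define \<delta> where "\<delta> = 1 - \<theta>"
  have \<delta>: "0 < \<delta>" "\<delta> < 1" "\<theta> = 1 - \<delta>" using assms by (auto simp: \<delta>_def)
  have sq: "0 \<le> \<delta>\<^sup>2" "\<delta>\<^sup>2 \<le> \<delta>" "0 \<le> \<delta>^3" using \<delta> by (auto simp: power2_eq_square mult_le_one)
  have "\<theta> * \<epsilon> \<le> \<epsilon>" using assms by (simp add: mult_left_le_one_le)
  then have "2 * \<theta> * (1 + \<epsilon>) \<le> 2 - 23 * \<delta> / 12"
    using sq assms(6) \<delta>(3) unfolding \<delta>_def[symmetric] distrib_left mult.assoc by linarith
  then have "E * (2 * \<theta> * (1 + \<epsilon>)) \<le> (1 + \<delta>\<^sup>2 / 6) * (2 - 23 * \<delta> / 12)"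
    using assms \<delta> by (intro mult_mono) auto
  also have "\<dots> = 2 - 23 * \<delta> / 12 + \<delta>\<^sup>2 / 3 - 23 * \<delta>^3 / 72"
    by (simp add: algebra_simps power2_eq_square power3_eq_cube)
  also have "\<dots> < 2 - 5 * \<delta> / 4 + \<delta>\<^sup>2 / 8"
    using sq \<delta> by linarith
  also have "\<dots> = (1 + \<theta>) * (1 - \<delta> / 8)"
    unfolding \<delta>(3) by (simp add: field_simps power2_eq_square)
  finally show ?thesis by (simp add: \<delta>_def)
qed

text \<open>A telescoping series; it serves both the construction of the eigenfunction and that of
  the functional.\<close>

lemma geometric_convergent:
  fixes s :: "nat \<Rightarrow> real"
  assumes "\<And>n. \<bar>s (Suc n) - s n\<bar> \<le> c * q ^ n" "0 \<le> q" "q < 1"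
  shows "convergent s"
proof -
  have "summable (\<lambda>n. c * q ^ n)"
    using assms by (intro summable_mult summable_geometric) simp
  then have "summable (\<lambda>n. s (Suc n) - s n)"
    by (rule summable_comparison_test'[of _ 0]) (use assms(1) in simp)
  then have "convergent (\<lambda>n. (\<Sum>i<n. s (Suc i) - s i) + s 0)"
    by (intro convergent_add convergent_const) (simp add: summable_iff_convergent)
  then show ?thesis by (simp add: sum_lessThan_telescope)
qed

text \<open>The setting after the potential has been shifted by a constant. The bound with 24 is
  what \<open>ln (1 + t) \<le> t\<close> and \<open>1 \<le> 1 + \<theta>\<close> leave of the
  smallness hypothesis: two thirds of one sixteenth.\<close>

locale weighted_branches =
  fixes \<alpha> \<theta> \<eta> D :: real and k :: nat and b :: "nat \<Rightarrow> 'a::metric_space \<Rightarrow> 'a"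
    and \<psi> :: "'a \<Rightarrow> real" and x\<^sub>0 :: 'a
  assumes bounded_space: "bounded (UNIV :: 'a set)"
    and D_eq: "D = diameter (UNIV :: 'a set) powr \<alpha>"
    and \<alpha>_pos: "0 < \<alpha>" and \<theta>_pos: "0 < \<theta>" and \<theta>_less_1: "\<theta> < 1" and k_pos: "0 < k"
    and branches_contract: "\<exists>\<sigma>. \<sigma> permutes {1..k} \<and>
        1 / real k * (\<Sum>j=1..k. dist (b j y) (b (\<sigma> j) z) powr \<alpha>) \<le> \<theta> * dist y z powr \<alpha>"
    and potential_holder: "holder_bound \<alpha> \<eta> \<psi>"
    and potential_nonneg: "0 \<le> \<psi> x"
    and potential_le: "\<psi> x \<le> 2 * (D * \<eta>)"
    and small: "D * \<eta> \<le> (1 - \<theta>)\<^sup>2 / 24"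
begin

abbreviation \<epsilon> :: real where "\<epsilon> \<equiv> D * \<eta>"
abbreviation E :: real where "E \<equiv> exp (2 * \<epsilon>)"
abbreviation A :: "('a \<Rightarrow> real) \<Rightarrow> 'a \<Rightarrow> real" where "A \<equiv> transfer_operator k b \<psi>"
abbreviation X :: "('a \<Rightarrow> real) set" where "X \<equiv> holder_space \<alpha>"
abbreviation N :: "('a \<Rightarrow> real) \<Rightarrow> real" where "N \<equiv> holder_norm \<alpha>"
text \<open>Normalised functions stay within \<open>a\<close> of \<open>1\<close>, so their images
  under \<open>A\<close> are at least \<open>1 - a\<close>. This is the denominator of
  \<open>\<kappa>\<close>, the rate at which Hoelder constants of differences shrink.\<close>

abbreviation a :: real where "a \<equiv> (1 - \<theta>) / 8"
abbreviation \<kappa> :: real where "\<kappa> \<equiv> E * (\<theta> * (1 + \<epsilon>) + a) / (1 - a)"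

text \<open>The Hoelder constant of the invariant set of normalised functions. The choice
  \<open>a / D\<close> would also do, but \<open>D\<close> may be \<open>0\<close>.\<close>

abbreviation C :: real where "C \<equiv> 3 * \<eta> / (1 - \<theta>)"

definition normalised :: "('a \<Rightarrow> real) \<Rightarrow> bool" where
  "normalised f \<longleftrightarrow> holder_bound \<alpha> C f \<and> f x\<^sub>0 = 1"

lemmas osc = holder_bound_osc[OF bounded_space \<alpha>_pos, folded D_eq]

lemma D_nonneg: "0 \<le> D"
  by (simp add: D_eq)

lemma \<eta>_nonneg: "0 \<le> \<eta>"
  using potential_holder by (rule holder_bound_nonneg)

lemma \<epsilon>_nonneg: "0 \<le> \<epsilon>"
  using \<eta>_nonneg D_nonneg by simp

lemma E_ge_1: "1 \<le> E"
  using \<epsilon>_nonneg by simp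

lemma delta_square_le: "(1 - \<theta>)\<^sup>2 \<le> 1 - \<theta>"
  using \<theta>_pos \<theta>_less_1 by (simp add: power2_eq_square mult_left_le_one_le)

lemma E_le: "E \<le> 1 + (1 - \<theta>)\<^sup>2 / 6"
proof -
  have "2 * \<epsilon> \<le> 1 / 2"
    using small delta_square_le \<theta>_pos by linarith
  then have "E \<le> 1 + 2 * (2 * \<epsilon>)"
    using \<epsilon>_nonneg by (intro real_exp_bound_lemma) auto
  then show ?thesis using small by linarith
qed

lemma a_bounds: "0 < a" "a < 1"
  using \<theta>_pos \<theta>_less_1 by auto

lemma C_nonneg: "0 \<le> C"
  using \<eta>_nonneg \<theta>_less_1 by simp

text \<open>The factor 3 in \<open>C\<close> and the 24 in the bound on \<open>\<epsilon>\<close>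
  combine to the eighth in \<open>a\<close>.\<close>

lemma D_C_le: "D * C \<le> a"
proof -
  have "3 * \<epsilon> \<le> a * (1 - \<theta>)" using small by (simp add: power2_eq_square)
  then show ?thesis using \<theta>_less_1 by (simp add: field_simps)
qed

lemma kappa_bounds: "0 \<le> \<kappa>" "\<kappa> < 1"
proof -
  show "0 \<le> \<kappa>"
    using a_bounds \<theta>_pos D_nonneg \<eta>_nonneg
    by (intro divide_nonneg_nonneg mult_nonneg_nonneg add_nonneg_nonneg) auto
  show "\<kappa> < 1"
    using contraction_estimate[OF \<theta>_pos \<theta>_less_1 E_ge_1 E_le \<epsilon>_nonneg small] a_bounds
    by (simp add: divide_less_eq)
qed

lemma exp_potential_bounds: "1 \<le> exp (\<psi> x)" "exp (\<psi> x) \<le> E"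
  using potential_nonneg potential_le by auto

text \<open>The exponential is Lipschitz with constant \<open>E\<close> below
  \<open>2 * \<epsilon>\<close>; factoring out the larger exponential reduces this to
  \<open>1 + x \<le> exp x\<close>.\<close>

lemma exp_potential_holder: "\<bar>exp (\<psi> x) - exp (\<psi> y)\<bar> \<le> E * \<eta> * dist x y powr \<alpha>"
proof -
  have le: "exp s - exp t \<le> E * (s - t)" if "s \<le> 2 * \<epsilon>" "t \<le> s" for s t :: real
  proof -
    have "exp s - exp t = exp s * (1 - exp (t - s))" by (simp add: algebra_simps exp_diff)
    also have "\<dots> \<le> E * (s - t)"
    proof (rule mult_mono)
      show "1 - exp (t - s) \<le> s - t" using exp_ge_add_one_self[of "t - s"] by linarith
    qed (use that in auto)
    finally show ?thesis .
  qed
  have "\<bar>exp (\<psi> x) - exp (\<psi> y)\<bar> \<le> E * \<bar>\<psi> x - \<psi> y\<bar>"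
    using le[OF potential_le[of x], of "\<psi> y"] le[OF potential_le[of y], of "\<psi> x"]
    by (cases "\<psi> x \<le> \<psi> y") auto
  also have "\<dots> \<le> E * (\<eta> * dist x y powr \<alpha>)"
    by (intro mult_left_mono holder_boundD[OF potential_holder]) simp
  finally show ?thesis by (simp add: mult.assoc)
qed

section \<open>Linearity, positivity and Hoelder bounds for the operator\<close>

lemma A_add: "A (f + f') = A f + A f'"
  by (simp add: transfer_operator_def fun_eq_iff algebra_simps sum.distrib)

lemma A_scaleR: "A (c *\<^sub>R f) = c *\<^sub>R A f"
  by (simp add: transfer_operator_def fun_eq_iff sum_distrib_left mult_ac)

lemma A_diff: "A (f - f') = A f - A f'"
  using A_add[of f "(-1) *\<^sub>R f'"] A_scaleR[of "-1" f'] by simp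

text \<open>Positivity of the operator, in a form that iterates and passes to \<open>\<nu>\<close>
  in the limit.\<close>

lemma A_abs_mono:
  assumes "\<And>x. \<bar>f x\<bar> \<le> f' x"
  shows "\<bar>A f x\<bar> \<le> A f' x"
proof -
  have "\<bar>\<Sum>j=1..k. exp (\<psi> (b j x)) * f (b j x)\<bar> \<le> (\<Sum>j=1..k. exp (\<psi> (b j x)) * f' (b j x))"
    by (rule sum_abs[THEN order_trans]) (auto simp: abs_mult intro!: sum_mono mult_left_mono assms)
  then show ?thesis
    by (simp add: transfer_operator_def abs_mult divide_right_mono)
qed

lemma A_abs_le:
  assumes "\<And>x. \<bar>f x\<bar> \<le> S"
  shows "\<bar>A f x\<bar> \<le> E * S"
proof -
  have S: "0 \<le> S" using assms[of x] by linarith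
  have "\<bar>A f x\<bar> \<le> A (\<lambda>_. S) x" by (rule A_abs_mono[OF assms])
  also have "\<dots> \<le> 1 / real k * (\<Sum>j=1..k. E * S)"
    unfolding transfer_operator_def
    by (intro mult_left_mono sum_mono mult_right_mono exp_potential_bounds S) auto
  also have "\<dots> = E * S" using k_pos by simp
  finally show ?thesis .
qed

text \<open>The weights are at least \<open>1\<close> because the shifted potential is
  nonnegative.\<close>

lemma A_ge:
  assumes "\<And>x. c \<le> f x" "0 \<le> c"
  shows "c \<le> A f x"
proof -
  have "c = 1 / real k * (\<Sum>j=1..k. 1 * c)" using k_pos by simp
  also have "\<dots> \<le> A f x"
    unfolding transfer_operator_def
    by (intro mult_left_mono sum_mono mult_mono exp_potential_bounds assms) auto
  finally show ?thesis .
qed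

text \<open>A Doeblin-Fortet inequality: matching the branches at two points by
  \<open>\<sigma>\<close> lets the average contraction act on the Hoelder constant, and the
  variation of the weights costs a multiple of the sup bound.\<close>

lemma A_holder:
  assumes f: "holder_bound \<alpha> K f" and S: "\<And>x. \<bar>f x\<bar> \<le> S"
  shows "holder_bound \<alpha> (\<theta> * E * (K + \<eta> * S)) (A f)"
  unfolding holder_bound_def
proof (intro conjI allI)
  let ?h = "\<lambda>x. exp (\<psi> x) * f x" and ?M = "E * (K + \<eta> * S)"
  have S0: "0 \<le> S" using S[of x\<^sub>0] by linarith
  have M0: "0 \<le> ?M" using S0 holder_bound_nonneg[OF f] \<eta>_nonneg by simp
  show "0 \<le> \<theta> * E * (K + \<eta> * S)"
    using mult_nonneg_nonneg[OF less_imp_le[OF \<theta>_pos] M0] by (simp add: mult.assoc)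
  have h: "\<bar>?h u - ?h v\<bar> \<le> ?M * dist u v powr \<alpha>" for u v
  proof -
    have "?h u - ?h v = exp (\<psi> u) * (f u - f v) + (exp (\<psi> u) - exp (\<psi> v)) * f v"
      by (simp add: algebra_simps)
    then have "\<bar>?h u - ?h v\<bar> \<le> exp (\<psi> u) * \<bar>f u - f v\<bar> + \<bar>exp (\<psi> u) - exp (\<psi> v)\<bar> * \<bar>f v\<bar>"
      by (metis abs_exp_cancel abs_mult abs_triangle_ineq)
    also have "\<dots> \<le> E * (K * dist u v powr \<alpha>) + (E * \<eta> * dist u v powr \<alpha>) * S"
      using \<eta>_nonneg
      by (intro add_mono mult_mono exp_potential_bounds exp_potential_holder S holder_boundD[OF f])
        auto
    finally show ?thesis by (simp add: algebra_simps)
  qed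
  fix y z
  obtain \<sigma> where \<sigma>: "\<sigma> permutes {1..k}"
    and le: "1 / real k * (\<Sum>j=1..k. dist (b j y) (b (\<sigma> j) z) powr \<alpha>) \<le> \<theta> * dist y z powr \<alpha>"
    using branches_contract by blast
  \<comment> \<open>Reindexing keeps the sum at \<open>z\<close> and pairs the branch values so that
    they are close on average.\<close>
  have "(\<Sum>j=1..k. ?h (b j z)) = (\<Sum>j=1..k. ?h (b (\<sigma> j) z))"
    using sum.permute[OF \<sigma>, of "\<lambda>j. ?h (b j z)"] by (simp add: o_def)
  then have "A f y - A f z = 1 / real k * (\<Sum>j=1..k. ?h (b j y) - ?h (b (\<sigma> j) z))"
    by (simp add: transfer_operator_def sum_subtractf diff_divide_distrib)
  then have "\<bar>A f y - A f z\<bar> = 1 / real k * \<bar>\<Sum>j=1..k. ?h (b j y) - ?h (b (\<sigma> j) z)\<bar>"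
    by (simp add: abs_mult)
  also have "\<dots> \<le> 1 / real k * (\<Sum>j=1..k. ?M * dist (b j y) (b (\<sigma> j) z) powr \<alpha>)"
    by (intro mult_left_mono order_trans[OF sum_abs] sum_mono h) auto
  also have "\<dots> = ?M * (1 / real k * (\<Sum>j=1..k. dist (b j y) (b (\<sigma> j) z) powr \<alpha>))"
    by (simp add: sum_distrib_left)
  also have "\<dots> \<le> ?M * (\<theta> * dist y z powr \<alpha>)"
    using le M0 by (rule mult_left_mono)
  finally show "\<bar>A f y - A f z\<bar> \<le> \<theta> * E * (K + \<eta> * S) * dist y z powr \<alpha>"
    by (simp add: mult_ac)
qed

lemma A_holder_space:
  assumes "f \<in> X"
  shows "A f \<in> X"
  using A_holder[OF holder_bound_Hol[OF assms] abs_le_Sup_abs[OF bounded_space \<alpha>_pos assms]]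
  by (rule holder_bound_imp)

text \<open>One estimate for two iterations: \<open>v\<close> is a normalised image and
  \<open>c\<close> a normalising value when the eigenfunction is sought, while \<open>v = u\<close>
  and \<open>c = lam\<close> when working modulo it. Since \<open>w\<close> vanishes at
  \<open>x\<^sub>0\<close>, its Hoelder bound also controls its sup norm.\<close>

lemma quotient_contraction:
  assumes w: "holder_bound \<alpha> W w" "w x\<^sub>0 = 0" and v: "holder_bound \<alpha> C v" and c: "1 - a \<le> c"
  shows "holder_bound \<alpha> (\<kappa> * W) (\<lambda>x. (A w x - A w x\<^sub>0 * v x) / c)"
proof -
  have W: "0 \<le> W" using w(1) by (rule holder_bound_nonneg)
  have c0: "0 < c" using c a_bounds by linarith
  have wb: "\<bar>w x\<bar> \<le> D * W" for x using osc[OF w(1), of x x\<^sub>0] w(2) by simp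
  \<comment> \<open>The cost of subtracting a multiple of \<open>v\<close>;
    \<open>D * C \<le> a\<close> turns it into the summand \<open>a\<close> of
    \<open>\<kappa>\<close>.\<close>
  have "\<bar>A w x\<^sub>0\<bar> * C \<le> E * (D * W) * C"
    by (intro mult_right_mono A_abs_le wb C_nonneg)
  also have "\<dots> = E * W * (D * C)" by (simp add: mult_ac)
  also have "\<dots> \<le> E * W * a" using W by (intro mult_left_mono D_C_le) simp
  finally have "\<theta> * E * (W + \<eta> * (D * W)) + \<bar>A w x\<^sub>0\<bar> * C \<le> E * (\<theta> * (1 + \<epsilon>) + a) * W"
    by (simp add: algebra_simps)
  then have h: "holder_bound \<alpha> (E * (\<theta> * (1 + \<epsilon>) + a) * W) (\<lambda>x. A w x - A w x\<^sub>0 * v x)"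
    by (rule holder_bound_mono[rotated])
      (intro holder_bound_diff holder_bound_cmult v A_holder[OF w(1) wb])
  have "holder_bound \<alpha> (\<bar>1 / c\<bar> * (E * (\<theta> * (1 + \<epsilon>) + a) * W))
      (\<lambda>x. 1 / c * (A w x - A w x\<^sub>0 * v x))"
    by (rule holder_bound_cmult[OF h])
  moreover have "\<bar>1 / c\<bar> * (E * (\<theta> * (1 + \<epsilon>) + a) * W) \<le> \<kappa> * W"
  proof -
    have "E * (\<theta> * (1 + \<epsilon>) + a) * W / c \<le> E * (\<theta> * (1 + \<epsilon>) + a) * W / (1 - a)"
    proof (rule divide_left_mono[OF c])
      show "0 \<le> E * (\<theta> * (1 + \<epsilon>) + a) * W"
        using W a_bounds \<theta>_pos D_nonneg \<eta>_nonneg by (intro mult_nonneg_nonneg add_nonneg_nonneg) auto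
      show "0 < c * (1 - a)" using c0 a_bounds by (intro mult_pos_pos) auto
    qed
    then show ?thesis using c0 by simp
  qed
  ultimately show ?thesis using holder_bound_mono by fastforce
qed

section \<open>Normalised functions and the eigenfunction\<close>

lemma normalised_bounds:
  assumes "normalised f"
  shows "1 - a \<le> f x" "f x \<le> 1 + a"
proof -
  have "\<bar>f x - f x\<^sub>0\<bar> \<le> D * C" by (rule osc) (use assms in \<open>simp add: normalised_def\<close>)
  with D_C_le assms show "1 - a \<le> f x" "f x \<le> 1 + a"
    unfolding normalised_def by linarith+
qed

lemma A_normalised_ge:
  assumes "normalised f"
  shows "1 - a \<le> A f x"
  using A_ge[of "1 - a" f] normalised_bounds[OF assms] a_bounds by simp

lemma normalised_step:
  assumes f: "normalised f"
  shows "normalised (\<lambda>x. A f x / A f x\<^sub>0)"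
proof -
  let ?c = "A f x\<^sub>0" and ?M = "\<theta> * E * (C + \<eta> * (1 + a))"
  have c: "1 - a \<le> ?c" by (rule A_normalised_ge[OF f])
  then have c0: "0 < ?c" using a_bounds by linarith
  have "\<bar>f x\<bar> \<le> 1 + a" for x
    using normalised_bounds[OF f, of x] a_bounds by linarith
  then have "holder_bound \<alpha> ?M (A f)"
    using f by (intro A_holder) (auto simp: normalised_def)
  then have "holder_bound \<alpha> (\<bar>1 / ?c\<bar> * ?M) (\<lambda>x. 1 / ?c * A f x)"
    by (rule holder_bound_cmult)
  moreover have "\<bar>1 / ?c\<bar> * ?M \<le> C"
  proof -
    \<comment> \<open>Both \<open>?M\<close> and \<open>C\<close> are multiples of
      \<open>\<eta> / (1 - \<theta>)\<close>; factoring this out avoids dividing by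
      \<open>\<eta>\<close>, which may vanish.\<close>
    have "?M = \<eta> / (1 - \<theta>) * (\<theta> * E * (3 + (1 - \<theta>) * (1 + a)))"
      using \<theta>_less_1 by (simp add: field_simps)
    also have "\<dots> \<le> \<eta> / (1 - \<theta>) * (3 * (1 - a))"
      using \<eta>_nonneg \<theta>_less_1
      by (intro mult_left_mono invariance_estimate[OF \<theta>_pos \<theta>_less_1 E_ge_1 E_le]) auto
    also have "\<dots> = C * (1 - a)" by simp
    also have "\<dots> \<le> C * ?c" using c C_nonneg by (rule mult_left_mono)
    finally show ?thesis using c0 by (simp add: divide_le_eq)
  qed
  ultimately show ?thesis
    using c0 holder_bound_mono unfolding normalised_def by fastforce
qed

lemma normalised_step_contraction:
  assumes f: "normalised f" and f': "normalised f'" and W: "holder_bound \<alpha> W (f - f')"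
  shows "holder_bound \<alpha> (\<kappa> * W) ((\<lambda>x. A f x / A f x\<^sub>0) - (\<lambda>x. A f' x / A f' x\<^sub>0))"
proof -
  let ?v = "\<lambda>x. A f' x / A f' x\<^sub>0"
  have pos: "0 < A f x\<^sub>0" "0 < A f' x\<^sub>0"
    using A_normalised_ge[OF f, of x\<^sub>0] A_normalised_ge[OF f', of x\<^sub>0] a_bounds by linarith+
  have "holder_bound \<alpha> (\<kappa> * W) (\<lambda>x. (A (f - f') x - A (f - f') x\<^sub>0 * ?v x) / A f x\<^sub>0)"
    using f f' normalised_step[OF f']
    by (intro quotient_contraction W A_normalised_ge) (auto simp: normalised_def)
  \<comment> \<open>Over the common denominator \<open>A f x\<^sub>0\<close>, the change of
    denominator appears as a multiple of \<open>?v\<close>.\<close>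
  also have "(\<lambda>x. (A (f - f') x - A (f - f') x\<^sub>0 * ?v x) / A f x\<^sub>0)
      = (\<lambda>x. A f x / A f x\<^sub>0) - ?v"
    using pos by (auto simp: A_diff fun_eq_iff field_simps)
  finally show ?thesis .
qed

lemma A_tendsto:
  assumes "\<And>x. (\<lambda>n. f n x) \<longlonglongrightarrow> g x"
  shows "(\<lambda>n. A (f n) x) \<longlonglongrightarrow> A g x"
  unfolding transfer_operator_def by (intro tendsto_intros assms)

text \<open>Fixed point iteration from the constant \<open>1\<close>. Differences of iterates vanish
  at \<open>x\<^sub>0\<close>, so the decay of their Hoelder constants forces geometric pointwise
  convergence.\<close>

lemma eigenfunction_exists:
  obtains u where "normalised u" "A u = A u x\<^sub>0 *\<^sub>R u"
proof -
  define F where "F f = (\<lambda>x. A f x / A f x\<^sub>0)" for f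
  define s where "s n = (F ^^ n) (\<lambda>_. 1)" for n
  have s_Suc: "s (Suc n) = F (s n)" for n by (simp add: s_def)
  have norm: "normalised (s n)" for n
  proof (induction n)
    case 0
    then show ?case using C_nonneg by (simp add: s_def normalised_def)
  next
    case (Suc n)
    then show ?case using normalised_step by (simp add: s_Suc F_def)
  qed
  \<comment> \<open>The initial \<open>2 * C\<close> is the triangle inequality for two normalised
    functions.\<close>
  have step: "holder_bound \<alpha> (2 * C * \<kappa> ^ n) (s (Suc n) - s n)" for n
  proof (induction n)
    case 0
    have "holder_bound \<alpha> (C + C) (\<lambda>x. s 1 x - s 0 x)"
      using norm by (intro holder_bound_diff) (auto simp: normalised_def)
    then show ?case by (simp add: fun_diff_def)
  next
    case (Suc n)
    have "holder_bound \<alpha> (\<kappa> * (2 * C * \<kappa> ^ n)) (s (Suc (Suc n)) - s (Suc n))"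
      using normalised_step_contraction[OF norm norm Suc]
      by (simp add: s_Suc[of "Suc n"] s_Suc[of n] F_def)
    then show ?case by (simp only: power_Suc mult_ac)
  qed
  have "convergent (\<lambda>n. s n x)" for x
  proof (rule geometric_convergent)
    fix n
    have "(s (Suc n) - s n) x\<^sub>0 = 0"
      using norm by (simp add: normalised_def)
    then show "\<bar>s (Suc n) x - s n x\<bar> \<le> D * (2 * C) * \<kappa> ^ n"
      using osc[OF step[of n], of x x\<^sub>0] by (simp add: mult_ac)
  qed (use kappa_bounds in auto)
  then obtain u where u: "\<And>x. (\<lambda>n. s n x) \<longlonglongrightarrow> u x"
    unfolding convergent_def by metis
  have nu: "normalised u"
    unfolding normalised_def
  proof
    show "holder_bound \<alpha> C u"
      by (rule holder_bound_lim[OF _ u]) (use norm in \<open>simp add: normalised_def\<close>)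
    have "(\<lambda>n. s n x\<^sub>0) \<longlonglongrightarrow> 1" using norm by (simp add: normalised_def)
    then show "u x\<^sub>0 = 1" using u LIMSEQ_unique by blast
  qed
  have pos: "0 < A u x\<^sub>0" using A_normalised_ge[OF nu, of x\<^sub>0] a_bounds by linarith
  \<comment> \<open>As a finite sum, \<open>A\<close> commutes with pointwise limits, so the
    recursion passes to the limit.\<close>
  have fixed: "A u x / A u x\<^sub>0 = u x" for x
  proof (rule LIMSEQ_unique)
    show "(\<lambda>n. s (Suc n) x) \<longlonglongrightarrow> A u x / A u x\<^sub>0"
      unfolding s_Suc F_def using pos by (intro tendsto_divide A_tendsto u) auto
    show "(\<lambda>n. s (Suc n) x) \<longlonglongrightarrow> u x" using u by (rule LIMSEQ_Suc)
  qed
  have "A u = A u x\<^sub>0 *\<^sub>R u"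
  proof
    fix x
    show "A u x = (A u x\<^sub>0 *\<^sub>R u) x"
      unfolding scaleR_fun_apply fixed[of x, symmetric] using pos by simp
  qed
  with nu show ?thesis by (rule that)
qed

end

section \<open>The eigenfunctional and the spectral gap\<close>

lemma has_spectral_gapI:
  assumes "banach_space_on X N" "bounded_operator_on X N L" "0 < C"
    and "0 < lam" "u \<in> X" "u \<noteq> 0" "L u = lam *\<^sub>R u"
    and "subspace G" "G \<subseteq> X" "closedin (Metric_space.mtopology X (norm_dist X N)) G"
    and "span {u} \<inter> G = {0}" "{v + g | v g. v \<in> span {u} \<and> g \<in> G} = X" "L ` G \<subseteq> G"
    and "0 < \<delta>" "\<delta> < 1" "\<And>n. onorm_on G N (L ^^ n) \<le> C * lam ^ n * (1 - \<delta>) ^ n"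
  shows "has_spectral_gap X N L C"
  unfolding has_spectral_gap_def
  by (intro conjI, rule assms, rule assms, rule assms, rule exI[of _ lam], rule exI[of _ u],
      rule exI[of _ G], rule exI[of _ \<delta>], intro conjI allI) (rule assms)+

locale weighted_eigenfunction = weighted_branches +
  fixes u :: "'a \<Rightarrow> real" and lam :: real
  assumes u_normalised: "normalised u" and A_u: "A u = lam *\<^sub>R u"
begin

lemma u_base: "u x\<^sub>0 = 1" and u_holder: "holder_bound \<alpha> C u"
  using u_normalised by (auto simp: normalised_def)

lemma lam_ge: "1 - a \<le> lam"
  using A_normalised_ge[OF u_normalised, of x\<^sub>0] by (simp add: A_u u_base)

lemma lam_pos: "0 < lam"
  using lam_ge a_bounds by linarith

text \<open>Base-point values of the iterates of \<open>A / lam\<close>. On \<open>X\<close> their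
  limit is a positive eigenvector of the dual operator, in the role of an eigenmeasure.\<close>

definition \<nu>_approx :: "('a \<Rightarrow> real) \<Rightarrow> nat \<Rightarrow> real" where
  "\<nu>_approx f n = (A ^^ n) f x\<^sub>0 / lam ^ n"

definition \<nu> :: "('a \<Rightarrow> real) \<Rightarrow> real" where
  "\<nu> f = lim (\<nu>_approx f)"

definition G :: "('a \<Rightarrow> real) set" where
  "G = {f \<in> X. \<nu> f = 0}"

text \<open>Modulo the eigenfunction, the iterates of \<open>A / lam\<close> decay geometrically, so the
  normalised values at the base point have summable increments.\<close>

lemma \<nu>_convergent:
  assumes "f \<in> X"
  shows "convergent (\<nu>_approx f)"
proof -
  define W where "W = Hol \<alpha> f + \<bar>f x\<^sub>0\<bar> * C"
  define w where "w n = (1 / lam ^ n) *\<^sub>R (A ^^ n) f - \<nu>_approx f n *\<^sub>R u" for n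
  have base: "w n x\<^sub>0 = 0" for n by (simp add: w_def \<nu>_approx_def u_base)
  have Aw: "A (w n) = (1 / lam ^ n) *\<^sub>R (A ^^ Suc n) f - (\<nu>_approx f n * lam) *\<^sub>R u" for n
    unfolding w_def A_diff A_scaleR A_u by simp
  \<comment> \<open>The increments of \<open>\<nu>_approx f\<close> are values of
    \<open>A (w n)\<close>, so geometric decay of \<open>w n\<close> suffices.\<close>
  have incr: "A (w n) x\<^sub>0 = lam * (\<nu>_approx f (Suc n) - \<nu>_approx f n)" for n
    using lam_pos unfolding Aw by (simp add: \<nu>_approx_def u_base field_simps)
  have step: "w (Suc n) x = (A (w n) x - A (w n) x\<^sub>0 * u x) / lam" for n x
    using lam_pos unfolding incr unfolding Aw by (simp add: w_def field_simps)
  have hb: "holder_bound \<alpha> (\<kappa> ^ n * W) (w n)" for n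
  proof (induction n)
    case 0
    have "holder_bound \<alpha> W (\<lambda>x. f x - f x\<^sub>0 * u x)"
      unfolding W_def by (intro holder_bound_diff holder_bound_cmult holder_bound_Hol assms u_holder)
    then show ?case by (simp add: w_def \<nu>_approx_def fun_diff_def)
  next
    case (Suc n)
    have "w (Suc n) = (\<lambda>x. (A (w n) x - A (w n) x\<^sub>0 * u x) / lam)"
      using step by blast
    then have "holder_bound \<alpha> (\<kappa> * (\<kappa> ^ n * W)) (w (Suc n))"
      using quotient_contraction[OF Suc base u_holder lam_ge] by simp
    then show ?case by (simp only: power_Suc mult.assoc)
  qed
  show ?thesis
  proof (rule geometric_convergent)
    fix n
    have "\<bar>w n x\<bar> \<le> D * (\<kappa> ^ n * W)" for x
      using osc[OF hb[of n], of x x\<^sub>0] base by simp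
    then have "\<bar>A (w n) x\<^sub>0\<bar> \<le> E * (D * (\<kappa> ^ n * W))" by (rule A_abs_le)
    then have "lam * \<bar>\<nu>_approx f (Suc n) - \<nu>_approx f n\<bar> \<le> E * D * W * \<kappa> ^ n"
      using lam_pos by (simp only: incr abs_mult abs_of_pos mult_ac)
    then have "\<bar>\<nu>_approx f (Suc n) - \<nu>_approx f n\<bar> \<le> E * D * W * \<kappa> ^ n / lam"
      using lam_pos by (simp only: pos_le_divide_eq mult.commute)
    then show "\<bar>\<nu>_approx f (Suc n) - \<nu>_approx f n\<bar> \<le> E * D * W / lam * \<kappa> ^ n"
      by (simp only: times_divide_eq_left)
  qed (rule kappa_bounds)+
qed

lemma \<nu>_tendsto:
  assumes "f \<in> X"
  shows "\<nu>_approx f \<longlonglongrightarrow> \<nu> f"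
  unfolding \<nu>_def using \<nu>_convergent[OF assms] by (simp add: convergent_LIMSEQ_iff)

lemma \<nu>_eqI: "f \<in> X \<Longrightarrow> \<nu>_approx f \<longlonglongrightarrow> l \<Longrightarrow> \<nu> f = l"
  using \<nu>_tendsto LIMSEQ_unique by blast

section \<open>Linearity, positivity and normalisation of the eigenfunctional\<close>

lemma A_pow_add: "(A ^^ n) (f + f') = (A ^^ n) f + (A ^^ n) f'"
  by (induction n) (simp_all only: funpow.simps id_apply o_apply A_add)

lemma A_pow_scaleR: "(A ^^ n) (c *\<^sub>R f) = c *\<^sub>R (A ^^ n) f"
  by (induction n) (simp_all only: funpow.simps id_apply o_apply A_scaleR)

lemma \<nu>_add:
  assumes "f \<in> X" "f' \<in> X"
  shows "\<nu> (f + f') = \<nu> f + \<nu> f'"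
proof (rule \<nu>_eqI)
  show "f + f' \<in> X" using assms by (rule subspace_add[OF subspace_holder_space])
  have "\<nu>_approx (f + f') = (\<lambda>n. \<nu>_approx f n + \<nu>_approx f' n)"
    by (simp add: \<nu>_approx_def A_pow_add add_divide_distrib fun_eq_iff)
  then show "\<nu>_approx (f + f') \<longlonglongrightarrow> \<nu> f + \<nu> f'"
    using tendsto_add[OF assms[THEN \<nu>_tendsto]] by simp
qed

lemma \<nu>_scaleR:
  assumes "f \<in> X"
  shows "\<nu> (c *\<^sub>R f) = c * \<nu> f"
proof (rule \<nu>_eqI)
  show "c *\<^sub>R f \<in> X" using assms by (rule subspace_scale[OF subspace_holder_space])
  have "\<nu>_approx (c *\<^sub>R f) = (\<lambda>n. c * \<nu>_approx f n)"
    by (simp add: \<nu>_approx_def A_pow_scaleR fun_eq_iff)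
  then show "\<nu>_approx (c *\<^sub>R f) \<longlonglongrightarrow> c * \<nu> f"
    using tendsto_mult_left[OF \<nu>_tendsto[OF assms]] by simp
qed

lemma \<nu>_diff:
  assumes "f \<in> X" "f' \<in> X"
  shows "\<nu> (f - f') = \<nu> f - \<nu> f'"
  using \<nu>_add[OF assms(1) subspace_scale[OF subspace_holder_space assms(2)], of "-1"]
    \<nu>_scaleR[OF assms(2), of "-1"] by simp

text \<open>Applying \<open>A\<close> first shifts the approximating sequence by one index, at the
  price of a factor \<open>lam\<close>.\<close>

lemma \<nu>_A:
  assumes "f \<in> X"
  shows "\<nu> (A f) = lam * \<nu> f"
proof (rule \<nu>_eqI)
  show "A f \<in> X" using assms by (rule A_holder_space)
  have "\<nu>_approx (A f) = (\<lambda>n. lam * \<nu>_approx f (Suc n))"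
    using lam_pos by (simp add: \<nu>_approx_def funpow_swap1 fun_eq_iff)
  then show "\<nu>_approx (A f) \<longlonglongrightarrow> lam * \<nu> f"
    using tendsto_mult_left[OF LIMSEQ_Suc[OF \<nu>_tendsto[OF assms]]] by simp
qed

lemma u_in_X: "u \<in> X"
  using u_holder by (rule holder_bound_imp)

lemma const_in_X: "(\<lambda>_. c) \<in> X"
  by (rule holder_bound_imp(1)[OF holder_bound_const[of 0]]) simp

lemma \<nu>_u: "\<nu> u = 1"
proof (rule \<nu>_eqI[OF u_in_X])
  have "(A ^^ n) u = lam ^ n *\<^sub>R u" for n
    by (induction n)
      (simp_all only: funpow.simps id_apply o_apply A_scaleR A_u scaleR_scaleR power.simps
        scaleR_one mult.commute)
  then show "\<nu>_approx u \<longlonglongrightarrow> 1"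
    using lam_pos u_base by (simp add: \<nu>_approx_def[abs_def])
qed

lemma \<nu>_abs_mono:
  assumes "f \<in> X" "f' \<in> X" "\<And>x. \<bar>f x\<bar> \<le> f' x"
  shows "\<bar>\<nu> f\<bar> \<le> \<nu> f'"
proof (rule LIMSEQ_le)
  show "(\<lambda>n. \<bar>\<nu>_approx f n\<bar>) \<longlonglongrightarrow> \<bar>\<nu> f\<bar>"
    by (intro tendsto_rabs \<nu>_tendsto assms)
  show "\<nu>_approx f' \<longlonglongrightarrow> \<nu> f'" by (intro \<nu>_tendsto assms)
  have "\<bar>(A ^^ n) f x\<bar> \<le> (A ^^ n) f' x" for n x
    by (induction n arbitrary: x) (auto intro: assms A_abs_mono)
  then show "\<exists>n0. \<forall>n\<ge>n0. \<bar>\<nu>_approx f n\<bar> \<le> \<nu>_approx f' n"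
    using lam_pos by (simp add: \<nu>_approx_def divide_right_mono)
qed

lemma \<nu>_const: "\<nu> (\<lambda>_. c) = c * \<nu> (\<lambda>_. 1)"
  using \<nu>_scaleR[OF const_in_X, of c 1] by (simp add: scaleR_fun_def)

text \<open>The eigenfunction is at most \<open>1 + a\<close> and satisfies
  \<open>\<nu> u = 1\<close>, so by monotonicity \<open>\<nu>\<close> is positive on constants that
  are positive.\<close>

lemma \<nu>_one_pos: "0 < \<nu> (\<lambda>_. 1)"
proof -
  have "\<bar>u x\<bar> \<le> 1 + a" for x
    using normalised_bounds[OF u_normalised, of x] a_bounds by linarith
  then have "\<bar>\<nu> u\<bar> \<le> \<nu> (\<lambda>_. 1 + a)" by (intro \<nu>_abs_mono u_in_X const_in_X)
  then have "1 \<le> (1 + a) * \<nu> (\<lambda>_. 1)" by (simp only: \<nu>_u \<nu>_const[of "1 + a"] abs_one)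
  then have "0 < (1 + a) * \<nu> (\<lambda>_. 1)" by linarith
  then show ?thesis using a_bounds by (simp add: zero_less_mult_iff)
qed

lemma \<nu>_abs_le:
  assumes "f \<in> X" "\<And>x. \<bar>f x\<bar> \<le> S"
  shows "\<bar>\<nu> f\<bar> \<le> S * \<nu> (\<lambda>_. 1)"
  using \<nu>_abs_mono[OF assms(1) const_in_X assms(2)] by (simp only: \<nu>_const[of S])

text \<open>A function killed by the positive functional \<open>\<nu>\<close> cannot stay away from \<open>0\<close>.\<close>

lemma abs_le_on_G:
  assumes "f \<in> G"
  shows "\<bar>f x\<bar> \<le> D * Hol \<alpha> f"
proof -
  have f: "f \<in> X" "\<nu> f = 0" using assms by (auto simp: G_def)
  \<comment> \<open>\<open>\<nu>\<close> cannot distinguish \<open>?g\<close> from the constant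
    \<open>- f x\<close>, while \<open>?g\<close> is bounded by the oscillation of
    \<open>f\<close>.\<close>
  let ?g = "f - (\<lambda>_. f x)"
  have "?g \<in> X" by (intro subspace_diff[OF subspace_holder_space] f const_in_X)
  moreover have "\<bar>?g y\<bar> \<le> D * Hol \<alpha> f" for y
    using osc[OF holder_bound_Hol[OF f(1)], of y x] by simp
  ultimately have "\<bar>\<nu> ?g\<bar> \<le> D * Hol \<alpha> f * \<nu> (\<lambda>_. 1)" by (rule \<nu>_abs_le)
  moreover have "\<nu> ?g = - f x * \<nu> (\<lambda>_. 1)"
    using \<nu>_diff[OF f(1) const_in_X, of "f x"] f(2) \<nu>_const[of "f x"] by simp
  ultimately have "\<bar>f x\<bar> * \<nu> (\<lambda>_. 1) \<le> D * Hol \<alpha> f * \<nu> (\<lambda>_. 1)"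
    using \<nu>_one_pos by (simp add: abs_mult)
  then show ?thesis using \<nu>_one_pos by simp
qed

section \<open>Contraction on the kernel of the functional\<close>

lemma A_in_G: "f \<in> G \<Longrightarrow> A f \<in> G"
  by (simp add: G_def A_holder_space \<nu>_A)

abbreviation \<rho> :: real where "\<rho> \<equiv> E * (2 * \<theta> * (1 + \<epsilon>)) / (1 + \<theta>)"

text \<open>Three bounds are available for \<open>A f\<close>: its sup norm is at most \<open>E\<close> times that of \<open>f\<close>, and at
  most its own seminorm, which is controlled by the contraction of the branches. The weights
  \<open>2 \<theta> / (1 + \<theta>)\<close> and \<open>(1 - \<theta>) / (1 + \<theta>)\<close> on the first two balance the coefficients.\<close>

lemma norm_A_le_on_G:
  assumes "f \<in> G"
  shows "N (A f) \<le> \<rho> * N f"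
proof -
  have f: "f \<in> X" and Af: "A f \<in> X" using assms A_in_G by (auto simp: G_def)
  define s h s' h' where "s = (SUP x. \<bar>f x\<bar>)" and "h = D * Hol \<alpha> f"
    and "s' = (SUP x. \<bar>A f x\<bar>)" and "h' = D * Hol \<alpha> (A f)"
  note b = abs_le_Sup_abs[OF bounded_space \<alpha>_pos f, folded s_def]
  have s0: "0 \<le> s" using Sup_abs_nonneg[OF bounded_space \<alpha>_pos f] by (simp add: s_def)
  have h0: "0 \<le> h" using D_nonneg by (simp add: h_def)
  have 1: "s' \<le> E * s" unfolding s'_def by (intro cSUP_least A_abs_le b) auto
  have 2: "s' \<le> h'" unfolding s'_def h'_def by (intro cSUP_least abs_le_on_G A_in_G assms) auto
  have "Hol \<alpha> (A f) \<le> \<theta> * E * (Hol \<alpha> f + \<eta> * s)"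
    by (rule holder_bound_imp(2)[OF A_holder[OF holder_bound_Hol[OF f] b]])
  then have "h' \<le> D * (\<theta> * E * (Hol \<alpha> f + \<eta> * s))"
    unfolding h'_def using D_nonneg by (rule mult_left_mono)
  also have "\<dots> = E * \<theta> * (h + \<epsilon> * s)" by (simp add: h_def algebra_simps)
  finally have 3: "h' \<le> E * \<theta> * (h + \<epsilon> * s)" .
  have "(1 + \<theta>) * (s' + h') = 2 * \<theta> * s' + (1 - \<theta>) * s' + (1 + \<theta>) * h'"
    by (simp add: algebra_simps)
  also have "\<dots> \<le> 2 * \<theta> * (E * s) + (1 - \<theta>) * h' + (1 + \<theta>) * h'"
    using 1 2 \<theta>_pos \<theta>_less_1 by (intro add_mono mult_left_mono) auto
  also have "\<dots> = 2 * \<theta> * (E * s) + 2 * h'" by (simp add: algebra_simps)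
  also have "\<dots> \<le> 2 * \<theta> * (E * s) + 2 * (E * \<theta> * (h + \<epsilon> * s))" using 3 by simp
  also have "\<dots> = E * (2 * \<theta>) * (h + (1 + \<epsilon>) * s)" by (simp add: algebra_simps)
  \<comment> \<open>The coefficient of \<open>h\<close> is raised to that of \<open>s\<close>, so
    that the bound becomes a multiple of \<open>N f\<close>.\<close>
  also have "\<dots> \<le> E * (2 * \<theta>) * ((1 + \<epsilon>) * h + (1 + \<epsilon>) * s)"
  proof (intro mult_left_mono add_right_mono)
    show "h \<le> (1 + \<epsilon>) * h"
      using mult_nonneg_nonneg[OF \<epsilon>_nonneg h0] unfolding distrib_right mult_1 by linarith
  qed (use \<theta>_pos in simp)
  also have "\<dots> = E * (2 * \<theta> * (1 + \<epsilon>)) * (s + h)" by (simp add: algebra_simps)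
  finally have "s' + h' \<le> E * (2 * \<theta> * (1 + \<epsilon>)) * (s + h) / (1 + \<theta>)"
    using \<theta>_pos by (simp add: pos_le_divide_eq mult.commute)
  then show ?thesis
    by (simp add: holder_norm_def s_def h_def s'_def h'_def D_eq)
qed

text \<open>The gap itself: \<open>\<rho>\<close> lies below \<open>1 - a\<close>, and
  \<open>lam\<close> does not.\<close>

lemma rho_bounds: "0 < \<rho>" "\<rho> < lam"
proof -
  show "0 < \<rho>"
    using \<theta>_pos D_nonneg \<eta>_nonneg
    by (intro divide_pos_pos mult_pos_pos add_pos_nonneg mult_nonneg_nonneg) auto
  have "\<rho> < 1 - a"
    using gap_estimate[OF \<theta>_pos \<theta>_less_1 E_ge_1 E_le \<epsilon>_nonneg small] \<theta>_pos
    by (simp add: divide_less_eq mult.commute)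
  with lam_ge show "\<rho> < lam" by linarith
qed

section \<open>The invariant splitting and the spectral gap\<close>

lemma subspace_G: "subspace G"
proof (rule subspaceI)
  show "0 \<in> G"
    using \<nu>_const[of 0] const_in_X[of 0] by (simp add: G_def zero_fun_def)
qed (auto simp: G_def \<nu>_add \<nu>_scaleR subspace_add[OF subspace_holder_space]
      subspace_scale[OF subspace_holder_space])

text \<open>The Hoelder norm dominates the sup norm, so \<open>\<nu>\<close> is continuous for it
  and has a closed kernel.\<close>

lemma closedin_G: "closedin (Metric_space.mtopology X (norm_dist X N)) G"
proof -
  note no = norm_on_holder[OF bounded_space \<alpha>_pos]
  interpret M: Metric_space X "norm_dist X N"
    by (rule Metric_space_norm_dist[OF subspace_holder_space no])
  have "f \<in> G" if F: "range F \<subseteq> G" and lim: "limitin M.mtopology F f sequentially" for F f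
  proof -
    have fX: "f \<in> X" using lim by (simp add: M.limit_metric_sequentially)
    have FX: "F n \<in> X" "\<nu> (F n) = 0" for n using F by (auto simp: G_def)
    have "\<bar>\<nu> f\<bar> \<le> 0"
    proof (rule field_le_epsilon)
      fix e :: real assume e: "0 < e"
      then have "0 < e / \<nu> (\<lambda>_. 1)" using \<nu>_one_pos by simp
      then obtain n where "norm_dist X N (F n) f < e / \<nu> (\<lambda>_. 1)"
        using lim unfolding M.limit_metric_sequentially by blast
      then have le: "N (F n - f) < e / \<nu> (\<lambda>_. 1)" using FX fX by (simp add: norm_dist_def)
      have dX: "F n - f \<in> X" by (intro subspace_diff[OF subspace_holder_space] FX fX)
      have "\<bar>\<nu> (F n - f)\<bar> \<le> N (F n - f) * \<nu> (\<lambda>_. 1)"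
        by (intro \<nu>_abs_le dX abs_le_holder_norm[OF bounded_space \<alpha>_pos])
      also have "\<dots> \<le> e" using le \<nu>_one_pos by (simp add: pos_less_divide_eq less_imp_le)
      finally show "\<bar>\<nu> f\<bar> \<le> 0 + e" using FX fX by (simp add: \<nu>_diff)
    qed
    then show ?thesis using fX by (simp add: G_def)
  qed
  moreover have "G \<subseteq> X" by (auto simp: G_def)
  ultimately show ?thesis
    unfolding M.metric_closedin_iff_sequentially_closed by blast
qed

lemma span_u_inter_G: "span {u} \<inter> G = {0}"
proof -
  have "v = 0" if v: "v \<in> span {u}" "v \<in> G" for v
  proof -
    obtain c where "v = c *\<^sub>R u" using v(1) unfolding span_singleton by blast
    then show ?thesis using v(2) \<nu>_scaleR[OF u_in_X, of c] \<nu>_u by (simp add: G_def)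
  qed
  then show ?thesis using subspace_0[OF subspace_G] span_zero by blast
qed

lemma span_u_plus_G: "{v + g | v g. v \<in> span {u} \<and> g \<in> G} = X"
proof (intro equalityI subsetI)
  have "span {u} \<subseteq> X" using u_in_X by (intro span_minimal subspace_holder_space) simp
  moreover fix f assume "f \<in> {v + g | v g. v \<in> span {u} \<and> g \<in> G}"
  then obtain v g where "f = v + g" "v \<in> span {u}" "g \<in> G" by blast
  ultimately show "f \<in> X"
    using subspace_add[OF subspace_holder_space, of v \<alpha> g] unfolding G_def by blast
next
  fix f assume f: "f \<in> X"
  \<comment> \<open>The projection of \<open>f\<close> to the span of \<open>u\<close> along
    \<open>G\<close>, by \<open>\<nu> u = 1\<close>.\<close>
  define v where "v = \<nu> f *\<^sub>R u"
  have v: "v \<in> span {u}" unfolding v_def by (intro span_scale span_base) simp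
  have vX: "v \<in> X" unfolding v_def by (intro subspace_scale[OF subspace_holder_space] u_in_X)
  have "\<nu> (f - v) = 0"
    unfolding \<nu>_diff[OF f vX] unfolding v_def \<nu>_scaleR[OF u_in_X] \<nu>_u by simp
  then have "f - v \<in> G"
    using subspace_diff[OF subspace_holder_space f vX] by (simp add: G_def)
  moreover have "f = v + (f - v)" by simp
  ultimately show "f \<in> {v + g | v g. v \<in> span {u} \<and> g \<in> G}" using v by blast
qed

lemma bounded_operator_A:
  assumes "0 < c"
  shows "bounded_operator_on X N (\<lambda>f. c *\<^sub>R A f)"
proof -
  note sub = subspace_holder_space and no = norm_on_holder[OF bounded_space \<alpha>_pos]
  have "N (c *\<^sub>R A f) \<le> c * (E * (1 + \<theta> * (1 + \<epsilon>))) * N f" if f: "f \<in> X" for f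
  proof -
    define s h where "s = (SUP x. \<bar>f x\<bar>)" and "h = D * Hol \<alpha> f"
    note b = abs_le_Sup_abs[OF bounded_space \<alpha>_pos f, folded s_def]
    have s0: "0 \<le> s" using Sup_abs_nonneg[OF bounded_space \<alpha>_pos f] by (simp add: s_def)
    have h0: "0 \<le> h" using D_nonneg by (simp add: h_def)
    have "N (A f) \<le> E * s + D * (\<theta> * E * (Hol \<alpha> f + \<eta> * s))"
      using holder_norm_le[OF A_abs_le[OF b] A_holder[OF holder_bound_Hol[OF f] b]]
      by (simp only: D_eq[symmetric])
    also have "\<dots> = E * (s + \<theta> * (h + \<epsilon> * s))" by (simp add: h_def algebra_simps)
    also have "\<dots> \<le> E * ((s + h) + \<theta> * ((1 + \<epsilon>) * (s + h)))"
    proof (intro mult_left_mono add_mono)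
      show "h + \<epsilon> * s \<le> (1 + \<epsilon>) * (s + h)"
        using mult_nonneg_nonneg[OF \<epsilon>_nonneg h0] s0
        unfolding distrib_right distrib_left mult_1 by linarith
    qed (use h0 \<theta>_pos in simp_all)
    also have "\<dots> = E * (1 + \<theta> * (1 + \<epsilon>)) * N f"
      by (simp add: holder_norm_def s_def h_def D_eq algebra_simps)
    finally have "c * N (A f) \<le> c * (E * (1 + \<theta> * (1 + \<epsilon>)) * N f)"
      using assms by simp
    moreover have "N (c *\<^sub>R A f) = c * N (A f)"
      using no A_holder_space[OF f] assms by (simp add: norm_on_def)
    ultimately show ?thesis by (simp only: mult.assoc)
  qed
  then have "\<exists>K. \<forall>f\<in>X. N (c *\<^sub>R A f) \<le> K * N f" by blast
  moreover have "(\<lambda>f. c *\<^sub>R A f) ` X \<subseteq> X"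
    using A_holder_space subspace_scale[OF sub] by blast
  ultimately show ?thesis
    unfolding bounded_operator_on_def A_add A_scaleR scaleR_add_right scaleR_scaleR
    by (simp only: mult.commute simp_thms ball_triv)
qed

text \<open>A factor \<open>c\<close> scales the eigenvalue and the norm bound on \<open>G\<close>
  alike, so their ratio survives; this serves to undo the shift of the potential.\<close>

lemma has_spectral_gap_scaled:
  assumes c: "0 < c"
  shows "has_spectral_gap X N (\<lambda>f. c *\<^sub>R A f) 1"
proof -
  define L where "L = (\<lambda>f. c *\<^sub>R A f)"
  define r where "r = c * \<rho>"
  define \<mu> where "\<mu> = c * lam"
  \<comment> \<open>Chosen so that \<open>\<mu> * (1 - \<delta>)\<close> is the one-step bound
    \<open>r\<close>; iterating it produces no further constant.\<close>
  define \<delta> where "\<delta> = 1 - r / \<mu>"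
  note no = norm_on_holder[OF bounded_space \<alpha>_pos]
  have \<mu>: "0 < \<mu>" unfolding \<mu>_def using c lam_pos by (rule mult_pos_pos)
  have r: "0 < r" "r < \<mu>"
    unfolding r_def \<mu>_def using c rho_bounds by (simp_all only: mult_pos_pos mult_strict_left_mono)
  have \<delta>: "0 < \<delta>" "\<delta> < 1" using r \<mu> by (simp_all add: \<delta>_def)
  have LG: "L f \<in> G" if "f \<in> G" for f
    unfolding L_def using that by (intro subspace_scale[OF subspace_G] A_in_G)
  have step: "N (L f) \<le> r * N f" if "f \<in> G" for f
  proof -
    have "A f \<in> X" using A_in_G[OF that] by (simp add: G_def)
    then have "N (L f) = c * N (A f)" using no c by (simp add: norm_on_def L_def)
    then show ?thesis
      using mult_left_mono[OF norm_A_le_on_G[OF that] less_imp_le[OF c]]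
      by (simp only: r_def mult.assoc)
  qed
  have iter: "(L ^^ n) f \<in> G \<and> N ((L ^^ n) f) \<le> r ^ n * N f" if f: "f \<in> G" for n f
  proof (induction n)
    case 0
    then show ?case using f by simp
  next
    case (Suc n)
    have "N (L ((L ^^ n) f)) \<le> r * N ((L ^^ n) f)" using Suc by (intro step) simp
    also have "\<dots> \<le> r * (r ^ n * N f)"
      using Suc r by (intro mult_left_mono) auto
    finally show ?case using LG Suc by (simp add: mult.assoc)
  qed
  have onorm: "onorm_on G N (L ^^ n) \<le> 1 * \<mu> ^ n * (1 - \<delta>) ^ n" for n
  proof -
    have "\<mu> * (1 - \<delta>) = r" using \<mu> by (simp add: \<delta>_def)
    then have eq: "1 * \<mu> ^ n * (1 - \<delta>) ^ n = r ^ n"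
      by (simp only: power_mult_distrib[symmetric] mult_1)
    have "N ((L ^^ n) f) / N f \<le> r ^ n" if f: "f \<in> G" for f
    \<comment> \<open>Division by zero gives the quotient \<open>0\<close> at the zero
      vector.\<close>
    proof (cases "N f = 0")
      case True
      then show ?thesis using r by simp
    next
      case False
      have "0 \<le> N f" using no f by (simp add: norm_on_def G_def)
      then have "0 < N f" using False by simp
      then show ?thesis using iter[OF f, of n] by (simp add: pos_divide_le_eq)
    qed
    then show ?thesis
      unfolding onorm_on_def eq using subspace_0[OF subspace_G] by (intro cSUP_least) auto
  qed
  have L_u: "L u = \<mu> *\<^sub>R u" by (simp only: L_def \<mu>_def A_u scaleR_scaleR)
  have u_nonzero: "u \<noteq> 0" using u_base by auto
  have L_G: "L ` G \<subseteq> G" using LG by blast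
  have G_X: "G \<subseteq> X" by (auto simp: G_def)
  have "bounded_operator_on X N L" unfolding L_def using c by (rule bounded_operator_A)
  then have "has_spectral_gap X N L 1"
    by (rule has_spectral_gapI[OF banach_space_on_holder[OF bounded_space \<alpha>_pos] _ zero_less_one
          \<mu> u_in_X u_nonzero L_u subspace_G G_X closedin_G span_u_inter_G span_u_plus_G L_G \<delta> onorm])
  then show ?thesis by (simp only: L_def)
qed

end

theorem theorem3p3:
  fixes T :: "'a::metric_space \<Rightarrow> 'a"
    and k :: nat and b :: "nat \<Rightarrow> 'a \<Rightarrow> 'a"
    and \<alpha> \<theta> :: real and \<phi> :: "'a \<Rightarrow> real"
  assumes "bounded (UNIV :: 'a set)"
    and "0 < \<alpha>" and "\<alpha> \<le> 1"
    and "0 < \<theta>" and "\<theta> < 1"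
    and "inverse_branches \<alpha> \<theta> T k b"
    and "\<phi> \<in> holder_space \<alpha>"
    and "holder_const \<alpha> \<phi> \<le>
           ennreal (2 / (3 * diameter (UNIV :: 'a set) powr \<alpha>)
                    * ln (1 + (1 - \<theta>)\<^sup>2 / (16 * (1 + \<theta>))))"
  shows "has_spectral_gap (holder_space \<alpha>) (holder_norm \<alpha>) (transfer_operator k b \<phi>) 1"
proof -
  define D where "D = diameter (UNIV :: 'a set) powr \<alpha>"
  define l where "l = ln (1 + (1 - \<theta>)\<^sup>2 / (16 * (1 + \<theta>)))"
  \<comment> \<open>On a one-point space \<open>D = 0\<close>, and division by zero makes
    \<open>\<eta>\<close> equal to \<open>0\<close>, in accordance with the hypothesis on
    \<open>holder_const\<close>.\<close>
  define \<eta> where "\<eta> = 2 / (3 * D) * l"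
  define x\<^sub>0 where "x\<^sub>0 = (undefined :: 'a)"
  \<comment> \<open>As \<open>\<phi>\<close> differs from its value at \<open>x\<^sub>0\<close> by
    at most \<open>D * \<eta>\<close>, this shift makes the potential range between \<open>0\<close>
    and \<open>2 * (D * \<eta>)\<close>.\<close>
  define p where "p = \<phi> x\<^sub>0 - D * \<eta>"
  let ?\<psi> = "\<lambda>x. \<phi> x - p"
  have l: "0 \<le> l" "l \<le> (1 - \<theta>)\<^sup>2 / 16"
  proof -
    let ?t = "(1 - \<theta>)\<^sup>2 / (16 * (1 + \<theta>))"
    have t: "0 \<le> ?t" using assms by simp
    then show "0 \<le> l" by (simp add: l_def)
    have "l \<le> ?t" unfolding l_def using t by (rule ln_add_one_self_le_self)
    also have "\<dots> \<le> (1 - \<theta>)\<^sup>2 / 16" using assms by (intro divide_left_mono) auto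
    finally show "l \<le> (1 - \<theta>)\<^sup>2 / 16" .
  qed
  have \<eta>0: "0 \<le> \<eta>" using l(1) by (simp add: \<eta>_def D_def)
  have \<phi>: "holder_bound \<alpha> \<eta> \<phi>"
    using assms(8) \<eta>0 by (simp only: \<eta>_def D_def l_def holder_const_le_iff)
  have small: "D * \<eta> \<le> (1 - \<theta>)\<^sup>2 / 24"
  proof (cases "D = 0")
    case False
    then have "D * \<eta> = 2 / 3 * l" by (simp add: \<eta>_def)
    then show ?thesis using l(2) by simp
  qed simp
  have osc: "\<bar>\<phi> x - \<phi> x\<^sub>0\<bar> \<le> D * \<eta>" for x
    unfolding D_def by (rule holder_bound_osc[OF assms(1,2) \<phi>])
  interpret weighted_branches \<alpha> \<theta> \<eta> D k b ?\<psi> x\<^sub>0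
  proof
    show "0 < k" using assms(6) by (simp add: inverse_branches_def)
    show "\<exists>\<sigma>. \<sigma> permutes {1..k} \<and>
        1 / real k * (\<Sum>j=1..k. dist (b j y) (b (\<sigma> j) z) powr \<alpha>) \<le> \<theta> * dist y z powr \<alpha>" for y z
      using assms(6) unfolding inverse_branches_def by blast
    show "holder_bound \<alpha> \<eta> ?\<psi>" using \<phi> by (simp add: holder_bound_def)
    show "0 \<le> ?\<psi> x" "?\<psi> x \<le> 2 * (D * \<eta>)" for x
      using osc[of x] unfolding p_def by linarith+
  qed (use assms small in \<open>simp_all add: D_def\<close>)
  obtain u where u: "normalised u" "A u = A u x\<^sub>0 *\<^sub>R u" by (rule eigenfunction_exists)
  interpret weighted_eigenfunction \<alpha> \<theta> \<eta> D k b ?\<psi> x\<^sub>0 u "A u x\<^sub>0"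
    by standard (rule u)+
  \<comment> \<open>Undoing the shift takes the factor \<open>exp p\<close> out of every
    weight.\<close>
  have "transfer_operator k b \<phi> = (\<lambda>f. exp p *\<^sub>R A f)"
  proof (intro ext)
    fix f x
    have "(\<Sum>j=1..k. exp (\<phi> (b j x)) * f (b j x))
        = exp p * (\<Sum>j=1..k. exp (\<phi> (b j x) - p) * f (b j x))"
      unfolding sum_distrib_left by (intro sum.cong refl) (simp add: exp_diff)
    then show "transfer_operator k b \<phi> f x = (exp p *\<^sub>R A f) x"
      by (simp add: transfer_operator_def)
  qed
  then show ?thesis using has_spectral_gap_scaled[OF exp_gt_zero[of p]] by (simp only:)
qed

end
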